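(* Let $n\ge1$ and $f,g\in \mathrm{Euc}(n)\cong\mathbf I(\mathbb E^n)$. Then $\sigma_f=\sigma_g$ if and only if the centralizers $\mathrm{Euc}(n)_f=\{h:hf=fh\}$ and $\mathrm{Euc}(n)_g$ are conjugate subgroups of $\mathrm{Euc}(n)$ (i.e. $f,g$ have the same orbit type under conjugation).
   Context: $\mathrm{Euc}(n)$ is the group of matrices $\begin{pmatrix}A&a\\0&1\end{pmatrix}$, $A\in O(n)$, $a\in\mathbb R^n$, acting on $\mathbb E^n=\{x\in\mathbb R^{n+1}:x_{n+1}=1\}$; for such $f$ put $\varphi=f$ (as a linear map of $\mathbb R^{n+1}$) and $\varphi_0=A$. Let $d=\dim\ker(\varphi-I)$ and $r=\dim\ker(A-I)$; then either $d=r+1$ ($f$ has a fixed point: type $e$, elliptic) or $d=r$ (type $h$, hyperbolic). Let $\varphi_R$ be the restriction of $A$ to the orthogonal complement of $\ker(A-I)$ in $\mathbb R^n$ (an orthogonal map with no eigenvalue $1$). The Segre symbol is $\sigma_f=[t;r;\tilde\sigma_{\varphi_R}]$ with $t\in\{e,h\}$, where for an orthogonal map $B$ the symbol $\tilde\sigma_B$ consists of the multiset of $\dim_{\mathbb C}\ker(B-\lambda)$ over the distinct conjugate pairs $\{\lambda,\bar\lambda\}$ of non-real eigenvalues, together with the multiset of $\dim\ker(B-\varepsilon)$ over the eigenvalues $\varepsilon\in\{\pm1\}$ of $B$. *)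

theory Defs
  imports "HOL-Analysis.Analysis" "HOL-Library.Multiset"
begin

text \<open>An element of Euc(n) is represented by the pair (A, a), standing for the block matrix
  [[A, a], [0, 1]] acting on E^n; the dimension n is the cardinality of the index type 'n.\<close>

type_synonym 'n euc = "(real^'n^'n) \<times> (real^'n)"

definition Euc :: "('n::finite) euc set" where
  "Euc = {(A, a). orthogonal_matrix A}"

text \<open>Matrix product of block matrices: [[A,a],[0,1]] [[B,b],[0,1]] = [[A B, A b + a],[0,1]].\<close>
definition euc_mult :: "('n::finite) euc \<Rightarrow> 'n euc \<Rightarrow> 'n euc" where
  "euc_mult f g = (fst f ** fst g, fst f *v snd g + snd f)"

definition euc_inv :: "('n::finite) euc \<Rightarrow> 'n euc" where
  "euc_inv f = (transpose (fst f), - (transpose (fst f) *v snd f))"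

definition centralizer :: "('n::finite) euc \<Rightarrow> 'n euc set" where
  "centralizer f = {h \<in> Euc. euc_mult h f = euc_mult f h}"

definition conjugate_subgroups :: "('n::finite) euc set \<Rightarrow> 'n euc set \<Rightarrow> bool" where
  "conjugate_subgroups H K \<longleftrightarrow>
     (\<exists>h\<in>Euc. (\<lambda>k. euc_mult (euc_mult h k) (euc_inv h)) ` H = K)"

text \<open>d = dim ker(phi - I), phi acting on R^(n+1) = R^n x R by phi(x,s) = (A x + s a, s).\<close>
definition d_dim :: "('n::finite) euc \<Rightarrow> nat" where
  "d_dim f = dim {p :: (real^'n) \<times> real. fst f *v fst p + snd p *\<^sub>R snd f = fst p}"

definition r_dim :: "('n::finite) euc \<Rightarrow> nat" where
  "r_dim f = dim {v :: real^'n. fst f *v v = v}"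

definition elliptic :: "('n::finite) euc \<Rightarrow> bool" where
  "elliptic f \<longleftrightarrow> d_dim f = r_dim f + 1"

text \<open>Orthogonal complement of ker(A - I); phi_R is the restriction of A to it.\<close>
definition R_space :: "real^'n^'n \<Rightarrow> (real^'n::finite) set" where
  "R_space A = {v. \<forall>u. A *v u = u \<longrightarrow> u \<bullet> v = 0}"

definition complexify :: "(real^'n::finite) set \<Rightarrow> (complex^'n) set" where
  "complexify W = {(\<chi> i. Complex (x $ i) (y $ i)) | x y. x \<in> W \<and> y \<in> W}"

definition cmat :: "real^'n^'m \<Rightarrow> complex^'n^'m" where
  "cmat A = (\<chi> i j. complex_of_real (A $ i $ j))"

definition ceig_space :: "real^'n^'n \<Rightarrow> (real^'n::finite) set \<Rightarrow> complex \<Rightarrow> (complex^'n) set" where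
  "ceig_space A W c = {z \<in> complexify W. cmat A *v z = c *s z}"

definition reig_space :: "real^'n^'n \<Rightarrow> (real^'n::finite) set \<Rightarrow> real \<Rightarrow> (real^'n) set" where
  "reig_space A W \<epsilon> = {v \<in> W. A *v v = \<epsilon> *\<^sub>R v}"

text \<open>Multiset of complex dimensions dim_C ker(phi_R - lambda) over the conjugate pairs of
  non-real eigenvalues (each pair represented by its member with positive imaginary part).\<close>
definition segre_nonreal :: "real^'n^'n \<Rightarrow> nat multiset" where
  "segre_nonreal A =
     image_mset (\<lambda>c. vec.dim (ceig_space A (R_space A) c))
       (mset_set {c. Im c > 0 \<and> ceig_space A (R_space A) c \<noteq> {0}})"

definition segre_real :: "real^'n^'n \<Rightarrow> nat multiset" where
  "segre_real A =
     image_mset (\<lambda>\<epsilon>. dim (reig_space A (R_space A) \<epsilon>))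
       (mset_set {\<epsilon> \<in> {1, -1}. reig_space A (R_space A) \<epsilon> \<noteq> {0}})"

text \<open>Segre symbol [t; r; sigma~(phi_R)], with t encoded as True = e, False = h.\<close>
definition segre :: "('n::finite) euc \<Rightarrow> bool \<times> nat \<times> nat multiset \<times> nat multiset" where
  "segre f = (elliptic f, r_dim f, segre_nonreal (fst f), segre_real (fst f))"

end

theory Submission
  imports Defs
begin

text \<open>
  An orthogonal map \<open>f\<close> splits the space orthogonally into the pieces
  \<open>W c = ker (f\<^sup>2 - 2 c f + 1)\<close>, the real form of the pair of eigenvalues with real part \<open>c\<close>;
  for \<open>-1 < c < 1\<close> the map \<open>(f - c) / sqrt (1 - c\<^sup>2)\<close> is an orthogonal complex structure on \<open>W c\<close>,
  and then \<open>dim (W c)\<close> is twice the dimension of the complex eigenspace. After conjugating by a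
  translation, \<open>f = (A, a)\<close> with \<open>A a = a\<close>, where \<open>a = 0\<close> exactly in the elliptic case, and the
  centralizer consists of all \<open>(B, b)\<close> with \<open>B A = A B\<close>, \<open>B a = a\<close> and \<open>A b = b\<close>.

  If the symbols agree, match the pieces by dimension and glue isometries commuting with the
  complex structures to an orthogonal \<open>P\<close>. On each piece, the conjugate of \<open>A'\<close> by \<open>P\<close> is an affine
  combination of \<open>A\<close> and \<open>1\<close>, so \<open>P\<close> carries one commutant onto the other. Conversely, conjugate
  \<open>A'\<close> to \<open>Q\<close> so that the centralizers have the same linear parts; their translations show that
  \<open>A\<close> and \<open>Q\<close> have the same fixed vectors. For \<open>c < 1\<close> and \<open>w \<in> W c\<close> the half-turn in the plane
  spanned by \<open>w\<close> and \<open>A w\<close> is such a linear part, so it commutes with \<open>Q\<close>; this makes \<open>Q + Q\<^sup>T\<close>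
  scalar on \<open>W c\<close>. By symmetry \<open>A\<close> and \<open>Q\<close> have the same pieces, and the symbols agree.\<close>

section \<open>Isotypic pieces of an orthogonal map\<close>

text \<open>For invertible \<open>f\<close> the equation says that \<open>f\<close> plus its inverse
  acts on \<open>v\<close> as \<open>2 * c\<close>; it is written without the inverse so that it
  makes sense for any map. For orthogonal \<open>f\<close>, \<open>c\<close> is the cosine of the
  rotation angle.\<close>

definition rot_space :: "('a::real_vector \<Rightarrow> 'a) \<Rightarrow> real \<Rightarrow> 'a set" where
  "rot_space f c = {v. f (f v) + v = (2 * c) *\<^sub>R f v}"

lemma subspace_rot_space:
  assumes "linear f"
  shows "subspace (rot_space f c)"
proof -
  interpret f: linear f by (rule assms)
  show ?thesis
  proof (rule subspaceI)
    fix x y assume "x \<in> rot_space f c" "y \<in> rot_space f c"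
    then have "(f (f x) + x) + (f (f y) + y) = (2 * c) *\<^sub>R f x + (2 * c) *\<^sub>R f y"
      by (simp add: rot_space_def)
    then show "x + y \<in> rot_space f c"
      by (simp add: rot_space_def f.add scaleR_add_right ac_simps)
  next
    fix k x assume "x \<in> rot_space f c"
    then have "k *\<^sub>R (f (f x) + x) = k *\<^sub>R ((2 * c) *\<^sub>R f x)"
      by (simp add: rot_space_def)
    then show "k *\<^sub>R x \<in> rot_space f c"
      by (simp add: rot_space_def f.scale scaleR_add_right mult.commute mult.left_commute)
  qed (simp add: rot_space_def f.zero)
qed

lemma zero_in_rot_space: "linear f \<Longrightarrow> 0 \<in> rot_space f c"
  by (simp add: subspace_0 subspace_rot_space)

lemma rot_space_nontrivial: "linear f \<Longrightarrow> rot_space f c \<noteq> {0} \<longleftrightarrow> (\<exists>v\<in>rot_space f c. v \<noteq> 0)"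
  using zero_in_rot_space[of f c] by auto

lemma rot_space_commute_mem:
  assumes "linear B" and comm: "\<And>x. B (f x) = f (B x)" and v: "v \<in> rot_space f c"
  shows "B v \<in> rot_space f c"
proof -
  have "B (f (f v) + v) = B ((2 * c) *\<^sub>R f v)"
    using v by (simp add: rot_space_def)
  then show ?thesis
    using \<open>linear B\<close> by (simp add: rot_space_def linear_add linear_scale comm)
qed

lemma rot_space_closed: "linear f \<Longrightarrow> v \<in> rot_space f c \<Longrightarrow> f v \<in> rot_space f c"
  by (rule rot_space_commute_mem) auto

text \<open>On the piece, \<open>f\<close> is inverted by \<open>2 c - f\<close>, by the quadratic
  relation. Thus \<open>f\<close> maps each piece onto itself.\<close>

lemma rot_space_preimage:
  assumes "linear f" "v \<in> rot_space f c"
  shows "(2 * c) *\<^sub>R v - f v \<in> rot_space f c" "f ((2 * c) *\<^sub>R v - f v) = v"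
proof -
  show "(2 * c) *\<^sub>R v - f v \<in> rot_space f c"
    using assms by (intro subspace_diff subspace_scale subspace_rot_space rot_space_closed)
  have "f (f v) + v = (2 * c) *\<^sub>R f v"
    using assms by (simp add: rot_space_def)
  then show "f ((2 * c) *\<^sub>R v - f v) = v"
    using assms(1) by (simp add: linear_diff linear_scale algebra_simps)
qed

text \<open>Pairing the defining equation with \<open>f v\<close> turns both terms on its left into
  \<open>f v \<bullet> v\<close>.\<close>

lemma rot_space_inner:
  assumes f: "orthogonal_transformation f" and v: "v \<in> rot_space f c"
  shows "f v \<bullet> v = c * (v \<bullet> v)"
proof -
  have "(f (f v) + v) \<bullet> f v = (2 * c) * (f v \<bullet> f v)"
    using v by (simp add: rot_space_def)
  moreover have "f (f v) \<bullet> f v = f v \<bullet> v" "f v \<bullet> f v = v \<bullet> v"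
    using f by (auto simp: orthogonal_transformation_def)
  ultimately show ?thesis
    by (simp add: inner_add_left inner_commute[of v "f v"])
qed

text \<open>This is orthogonality of eigenvectors of the self-adjoint map \<open>f\<close> plus its
  inverse: both pairings in the proof equal \<open>f u \<bullet> v + u \<bullet> f v\<close>, and
  they evaluate to \<open>2 c\<close> and \<open>2 d\<close> times
  \<open>u \<bullet> v\<close>.\<close>

lemma rot_space_orthogonal:
  assumes f: "orthogonal_transformation f"
    and u: "u \<in> rot_space f c" and v: "v \<in> rot_space f d" and "c \<noteq> d"
  shows "u \<bullet> v = 0"
proof -
  have *: "f x \<bullet> f y = x \<bullet> y" for x y
    using f by (auto simp: orthogonal_transformation_def)
  have "(f (f u) + u) \<bullet> f v = (2 * c) * (u \<bullet> v)"
    using u * by (simp add: rot_space_def)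
  moreover have "f u \<bullet> (f (f v) + v) = (2 * d) * (u \<bullet> v)"
    using v * by (simp add: rot_space_def)
  moreover have "(f (f u) + u) \<bullet> f v = f u \<bullet> (f (f v) + v)"
    by (simp add: inner_add_left inner_add_right *)
  ultimately show ?thesis
    using \<open>c \<noteq> d\<close> by simp
qed

lemma rot_space_disjoint:
  assumes "orthogonal_transformation f" "u \<in> rot_space f c" "u \<in> rot_space f d" "u \<noteq> 0"
  shows "c = d"
  using rot_space_orthogonal[OF assms(1-3)] assms(4) by auto

text \<open>By \<open>rot_space_inner\<close>, \<open>c\<close> is the cosine of the angle between
  \<open>v\<close> and \<open>f v\<close>, so Cauchy-Schwarz applies.\<close>

lemma rot_space_bound:
  assumes f: "orthogonal_transformation f" and v: "v \<in> rot_space f c" and "v \<noteq> 0"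
  shows "\<bar>c\<bar> \<le> 1"
proof -
  have "\<bar>f v \<bullet> v\<bar> \<le> norm (f v) * norm v"
    by (rule Cauchy_Schwarz_ineq2)
  moreover have "norm (f v) * norm v = v \<bullet> v"
    using f by (simp add: orthogonal_transformation dot_square_norm power2_eq_square)
  moreover have "\<bar>f v \<bullet> v\<bar> = \<bar>c\<bar> * (v \<bullet> v)"
    by (simp add: rot_space_inner[OF f v] abs_mult)
  ultimately have "\<bar>c\<bar> * (v \<bullet> v) \<le> 1 * (v \<bullet> v)"
    by simp
  then show ?thesis
    using \<open>v \<noteq> 0\<close> by (simp only: mult_le_cancel_right inner_gt_zero_iff) auto
qed

text \<open>At \<open>e = 1\<close> or \<open>e = -1\<close> the quadratic is the square of
  \<open>f - e\<close>. The double root collapses because the squared norm of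
  \<open>f v - e v\<close> is \<open>(1 - e * e) * (v \<bullet> v) = 0\<close>.\<close>

lemma rot_space_unit:
  assumes f: "orthogonal_transformation f" and e: "\<bar>e\<bar> = 1"
  shows "v \<in> rot_space f e \<longleftrightarrow> f v = e *\<^sub>R v"
proof
  assume v: "v \<in> rot_space f e"
  have e2: "e * e = 1"
    using e by (metis abs_mult_self_eq mult_1)
  have "(f v - e *\<^sub>R v) \<bullet> (f v - e *\<^sub>R v) = f v \<bullet> f v - 2 * e * (f v \<bullet> v) + e * e * (v \<bullet> v)"
    by (simp add: inner_diff_left inner_diff_right inner_commute algebra_simps)
  also have "\<dots> = (1 - e * e) * (v \<bullet> v)"
    using f by (simp add: rot_space_inner[OF f v] orthogonal_transformation_def algebra_simps)
  finally show "f v = e *\<^sub>R v"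
    using e2 by simp
next
  assume v: "f v = e *\<^sub>R v"
  have e2: "e * e = 1"
    using e by (metis abs_mult_self_eq mult_1)
  have "f (f v) = v"
    using v e2 f by (simp add: orthogonal_transformation_scaleR)
  then show "v \<in> rot_space f e"
    using v e2 scaleR_2[of v] by (simp add: rot_space_def mult.assoc)
qed

lemma rot_space_one:
  "orthogonal_transformation f \<Longrightarrow> rot_space f 1 = {v. f v = v}"
  using rot_space_unit[of f 1] by auto

lemma rot_space_minus_one:
  "orthogonal_transformation f \<Longrightarrow> rot_space f (-1) = {v. f v = - v}"
  using rot_space_unit[of f "-1"] by auto

text \<open>One nonzero vector chosen from each nontrivial piece gives a pairwise orthogonal, hence
  independent, hence finite family.\<close>

lemma finite_rot_spaces:
  fixes f :: "'a::euclidean_space \<Rightarrow> 'a"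
  assumes f: "orthogonal_transformation f"
  shows "finite {c. rot_space f c \<noteq> {0}}"
proof -
  let ?C = "{c. rot_space f c \<noteq> {0}}"
  have "\<exists>v. v \<in> rot_space f c \<and> v \<noteq> 0" if "c \<in> ?C" for c
    using that zero_in_rot_space[of f c] f by (auto simp: orthogonal_transformation_def)
  then obtain b where b: "\<And>c. c \<in> ?C \<Longrightarrow> b c \<in> rot_space f c" "\<And>c. c \<in> ?C \<Longrightarrow> b c \<noteq> 0"
    by metis
  have inj: "inj_on b ?C"
    by (intro inj_onI) (metis b f rot_space_disjoint)
  have "pairwise orthogonal (b ` ?C)"
    by (auto simp: pairwise_def orthogonal_def intro!: rot_space_orthogonal[OF f] b)
  then have "independent (b ` ?C)"
    by (rule pairwise_orthogonal_independent) (metis b(2) imageE)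
  then have "finite (b ` ?C)"
    by (rule independent_imp_finite)
  then show ?thesis
    using inj by (rule finite_imageD)
qed

text \<open>A maximiser \<open>u = f y\<close> of the Rayleigh quotient of \<open>f\<close> on the unit sphere of \<open>V\<close> is an
  eigenvector of \<open>f\<close> plus its inverse.\<close>
lemma exists_rot_vector:
  fixes f :: "'a::euclidean_space \<Rightarrow> 'a"
  assumes f: "orthogonal_transformation f" and V: "subspace V" "V \<noteq> {0}" and fV: "f ` V = V"
  obtains y c where "y \<in> V" "y \<noteq> 0" "y \<in> rot_space f c"
proof -
  have lin: "linear f" and isom: "\<And>x y. f x \<bullet> f y = x \<bullet> y"
    using f by (auto simp: orthogonal_transformation_def)
  let ?S = "sphere 0 1 \<inter> V"
  have "compact ?S"
    by (intro compact_Int_closed closed_subspace V) auto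
  obtain z where z: "z \<in> V" "z \<noteq> 0"
    using V subspace_0 by blast
  then have "z /\<^sub>R norm z \<in> ?S"
    using V by (auto intro: subspace_scale)
  then have "?S \<noteq> {}" by blast
  have "continuous_on ?S (\<lambda>x. f x \<bullet> x)"
    using lin by (intro continuous_intros linear_continuous_on) (simp add: linear_conv_bounded_linear)
  then obtain u where u: "u \<in> ?S" and max: "\<And>x. x \<in> ?S \<Longrightarrow> f x \<bullet> x \<le> f u \<bullet> u"
    using continuous_attains_sup[OF \<open>compact ?S\<close> \<open>?S \<noteq> {}\<close>] by blast
  define c where "c = f u \<bullet> u"
  \<comment> \<open>Homogeneity extends maximality from the unit sphere to all of
    \<open>V\<close>.\<close>
  have le: "f x \<bullet> x \<le> c * (x \<bullet> x)" if "x \<in> V" for x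
  proof (cases "x = 0")
    case False
    then have "x /\<^sub>R norm x \<in> ?S"
      using V that by (auto intro: subspace_scale)
    then have "f (x /\<^sub>R norm x) \<bullet> (x /\<^sub>R norm x) \<le> c"
      using max c_def by blast
    then show ?thesis
      using False by (simp add: linear_scale[OF lin] divide_simps power2_eq_square
          flip: power2_norm_eq_inner split: if_splits)
  qed (use lin in \<open>simp add: linear_0\<close>)
  obtain y where y: "y \<in> V" "u = f y"
    using u fV by blast
  \<comment> \<open>Since \<open>y\<close> is the preimage of \<open>u\<close>, this is
    \<open>f\<close> plus its inverse minus \<open>2 c\<close>, applied to \<open>u\<close>: the
    gradient of \<open>f x \<bullet> x - c * (x \<bullet> x)\<close> at \<open>u\<close>.\<close>
  define g where "g = f u + y - (2 * c) *\<^sub>R u"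
  have uV: "u \<in> V" "u \<bullet> u = 1"
    using u by (auto simp: norm_eq_1)
  have gV: "g \<in> V"
    unfolding g_def using uV y V fV by (intro subspace_diff subspace_add subspace_scale) auto
  \<comment> \<open>The maximum is tested at \<open>u + t *\<^sub>R g\<close>: the first-order gain
    is bounded by the second-order terms.\<close>
  have quad: "t * (g \<bullet> g) \<le> t\<^sup>2 * (c * (g \<bullet> g) - f g \<bullet> g)" for t
  proof -
    have "f (u + t *\<^sub>R g) \<bullet> (u + t *\<^sub>R g) \<le> c * ((u + t *\<^sub>R g) \<bullet> (u + t *\<^sub>R g))"
      by (intro le subspace_add subspace_scale V uV gV)
    then have 1: "c + t * (f u \<bullet> g + f g \<bullet> u) + t\<^sup>2 * (f g \<bullet> g) \<le> c * (1 + 2 * t * (u \<bullet> g) + t\<^sup>2 * (g \<bullet> g))"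
      using uV by (simp add: linear_add[OF lin] linear_scale[OF lin] inner_add_left inner_add_right
          c_def inner_commute power2_eq_square algebra_simps)
    have "f g \<bullet> u = g \<bullet> y"
      using y isom by simp
    moreover have "g \<bullet> g = f u \<bullet> g + g \<bullet> y - 2 * c * (u \<bullet> g)"
      by (subst (2) g_def) (simp add: inner_diff_right inner_add_right inner_commute)
    ultimately have "g \<bullet> g = f u \<bullet> g + f g \<bullet> u - 2 * c * (u \<bullet> g)"
      by simp
    then have "t * (g \<bullet> g) = t * (f u \<bullet> g + f g \<bullet> u - 2 * c * (u \<bullet> g))"
      by simp
    with 1 show ?thesis
      by (simp add: algebra_simps)
  qed
  have "g \<bullet> g = 0"
  proof (rule ccontr)
    assume "g \<bullet> g \<noteq> 0"
    then have pos: "g \<bullet> g > 0" by simp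
    define K where "K = c * (g \<bullet> g) - f g \<bullet> g"
    \<comment> \<open>For this \<open>t\<close> one has
      \<open>t * (\<bar>K\<bar> + g \<bullet> g) = g \<bullet> g\<close>, hence
      \<open>t * \<bar>K\<bar> < g \<bullet> g\<close>, against \<open>quad\<close> divided by
      \<open>t\<close>.\<close>
    define t where "t = (g \<bullet> g) / (\<bar>K\<bar> + g \<bullet> g)"
    have t: "t > 0" using pos by (simp add: t_def add_nonneg_pos)
    have "t * (g \<bullet> g) \<le> t * (t * K)"
      using quad[of t] by (simp add: K_def power2_eq_square mult.assoc)
    then have "g \<bullet> g \<le> t * K"
      using t by (simp add: mult_le_cancel_left_pos)
    also have "\<dots> \<le> t * \<bar>K\<bar>"
      using t by (intro mult_left_mono) auto
    also have "\<dots> < t * (\<bar>K\<bar> + g \<bullet> g)"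
      using t pos by simp
    also have "\<dots> = g \<bullet> g"
      using pos by (simp add: t_def add_nonneg_eq_0_iff)
    finally show False by simp
  qed
  then have "y \<in> rot_space f c"
    using y by (simp add: g_def rot_space_def)
  moreover have "y \<noteq> 0"
    using y uV linear_0[OF lin] by auto
  ultimately show thesis
    using that y by blast
qed

text \<open>The orthogonal complement of all pieces is mapped onto itself by \<open>f\<close>. Were
  it nonzero, \<open>exists_rot_vector\<close> would find in it a nonzero vector of some piece,
  which is then orthogonal to itself.\<close>

lemma span_rot_spaces:
  fixes f :: "'a::euclidean_space \<Rightarrow> 'a"
  assumes f: "orthogonal_transformation f"
  shows "span (\<Union>c. rot_space f c) = UNIV"
proof (rule ccontr)
  have lin: "linear f" and isom: "\<And>x y. f x \<bullet> f y = x \<bullet> y"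
    using f by (auto simp: orthogonal_transformation_def)
  let ?U = "\<Union>c. rot_space f c"
  define V where "V = {x. \<forall>u\<in>?U. u \<bullet> x = 0}"
  assume "span ?U \<noteq> UNIV"
  then obtain a where a: "a \<noteq> 0" "\<And>x. x \<in> span ?U \<Longrightarrow> a \<bullet> x = 0"
    by (metis UNIV_I orthogonal_to_subspace_exists_gen orthogonal_def psubsetI span_UNIV subset_UNIV)
  have "a \<in> V"
    unfolding V_def
  proof clarify
    fix u c assume "u \<in> rot_space f c"
    then have "u \<in> span ?U" by (blast intro: span_base)
    then show "u \<bullet> a = 0" using a(2) inner_commute by metis
  qed
  have "subspace V"
    by (auto simp: V_def subspace_def inner_add_right)
  have "f ` V = V"
  proof
    show "f ` V \<subseteq> V"
    proof clarsimp
      fix x assume x: "x \<in> V"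
      show "f x \<in> V"
        unfolding V_def
      proof clarify
        fix u c assume "u \<in> rot_space f c"
        then obtain w where "w \<in> rot_space f c" "u = f w"
          by (metis rot_space_preimage[OF lin])
        then show "u \<bullet> f x = 0"
          using x isom by (auto simp: V_def)
      qed
    qed
    show "V \<subseteq> f ` V"
    proof
      fix x assume x: "x \<in> V"
      obtain w where w: "x = f w"
        using orthogonal_transformation_surj[OF f] by (metis surjD)
      have "w \<in> V"
        unfolding V_def
      proof clarify
        fix u c assume "u \<in> rot_space f c"
        then have "f u \<in> ?U" using rot_space_closed[OF lin] by blast
        then have "f u \<bullet> f w = 0"
          using x w by (auto simp: V_def)
        then show "u \<bullet> w = 0" by (simp add: isom)
      qed
      then show "x \<in> f ` V" using w by blast
    qed
  qed
  then obtain y c where "y \<in> V" "y \<noteq> 0" "y \<in> rot_space f c"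
    using exists_rot_vector[OF f \<open>subspace V\<close>] \<open>a \<in> V\<close> a by blast
  then have "y \<bullet> y = 0"
    unfolding V_def by blast
  then show False
    using \<open>y \<noteq> 0\<close> by simp
qed

section \<open>Maps with the same orthogonal commutant\<close>

text \<open>The last clause characterizes \<open>p v\<close>. Linearity of \<open>p\<close>, and
  later its commutation with isometries preserving \<open>V\<close>, follow from it by checking
  membership and orthogonality.\<close>

lemma orthogonal_projection_exists:
  fixes V :: "'a::euclidean_space set"
  assumes "subspace V"
  obtains p where "linear p" "\<And>v. p v \<in> V" "\<And>u v. u \<in> V \<Longrightarrow> u \<bullet> (v - p v) = 0"
    "\<And>v y. y \<in> V \<Longrightarrow> (\<And>u. u \<in> V \<Longrightarrow> u \<bullet> (v - y) = 0) \<Longrightarrow> p v = y"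
proof -
  have "\<exists>y. y \<in> V \<and> (\<forall>u\<in>V. u \<bullet> (v - y) = 0)" for v
  proof -
    obtain y z where "y \<in> span V" "\<And>w. w \<in> span V \<Longrightarrow> orthogonal z w" "v = y + z"
      using orthogonal_subspace_decomp_exists[of V v] by metis
    then show ?thesis
      using iffD2[OF span_eq_iff assms] by (intro exI[of _ y]) (simp add: orthogonal_def inner_commute)
  qed
  then obtain p where p: "\<And>v. p v \<in> V" "\<And>u v. u \<in> V \<Longrightarrow> u \<bullet> (v - p v) = 0"
    by metis
  have uniq: "p v = y" if "y \<in> V" "\<And>u. u \<in> V \<Longrightarrow> u \<bullet> (v - y) = 0" for v y
  proof -
    have "p v - y \<in> V"
      using assms p that by (intro subspace_diff)
    then have "(p v - y) \<bullet> (v - y) - (p v - y) \<bullet> (v - p v) = 0"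
      using p that by simp
    moreover have "(p v - y) \<bullet> (v - y) - (p v - y) \<bullet> (v - p v) = (p v - y) \<bullet> (p v - y)"
      by (simp add: inner_diff_right)
    ultimately show ?thesis by simp
  qed
  have "linear p"
  proof (rule linearI)
    show "p (x + y) = p x + p y" for x y
    proof (rule uniq)
      fix u assume "u \<in> V"
      then have "u \<bullet> (x - p x) + u \<bullet> (y - p y) = 0"
        using p by simp
      then show "u \<bullet> (x + y - (p x + p y)) = 0"
        by (simp add: inner_diff_right inner_add_right)
    qed (use assms p in \<open>auto intro: subspace_add\<close>)
    show "p (k *\<^sub>R x) = k *\<^sub>R p x" for k x
    proof (rule uniq)
      fix u assume "u \<in> V"
      then have "k * (u \<bullet> (x - p x)) = 0"
        using p by simp
      then show "u \<bullet> (k *\<^sub>R x - k *\<^sub>R p x) = 0"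
        by (simp add: inner_diff_right right_diff_distrib)
    qed (use assms p in \<open>auto intro: subspace_scale\<close>)
  qed
  then show thesis
    using that p uniq by blast
qed

text \<open>\<open>R\<close> is \<open>1 - 2 p\<close> with \<open>p\<close> the projection onto
  \<open>V\<close>: a half-turn when \<open>V\<close> is a plane, a hyperplane reflection when
  \<open>V\<close> is a line. Since \<open>V\<close> is an eigenspace of \<open>R\<close>, linear
  maps commuting with \<open>R\<close> preserve \<open>V\<close>; the last clause is the converse
  for isometries.\<close>

lemma reflection_exists:
  fixes V :: "'a::euclidean_space set"
  assumes "subspace V"
  obtains R where "orthogonal_transformation R" "\<And>v. R v = - v \<longleftrightarrow> v \<in> V"
    "\<And>v. R v = v \<longleftrightarrow> (\<forall>u\<in>V. u \<bullet> v = 0)"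
    "\<And>f x. orthogonal_transformation f \<Longrightarrow> f ` V = V \<Longrightarrow> R (f x) = f (R x)"
proof -
  obtain p where p: "linear p" "\<And>v. p v \<in> V" "\<And>u v. u \<in> V \<Longrightarrow> u \<bullet> (v - p v) = 0"
    and uniq: "\<And>v y. y \<in> V \<Longrightarrow> (\<And>u. u \<in> V \<Longrightarrow> u \<bullet> (v - y) = 0) \<Longrightarrow> p v = y"
    using orthogonal_projection_exists[OF assms] by metis
  define R where "R v = v - 2 *\<^sub>R p v" for v
  have lin: "linear R"
    unfolding R_def using p(1) by (intro linear_compose_sub linear_ident linear_compose_scale_right)
  have "norm (R v) = norm v" for v
  proof -
    have "R v \<bullet> R v = v \<bullet> v - 4 * (p v \<bullet> (v - p v))"
      by (simp add: R_def inner_diff_left inner_diff_right inner_commute)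
    also have "\<dots> = v \<bullet> v"
      by (simp only: p(3)[OF p(2)])
    finally show ?thesis
      by (simp add: norm_eq)
  qed
  with lin have R: "orthogonal_transformation R"
    by (simp add: orthogonal_transformation)
  have neg: "R v = - v \<longleftrightarrow> v \<in> V" for v
  proof
    assume "R v = - v"
    then have "2 *\<^sub>R (v - p v) = 0"
      by (simp add: R_def algebra_simps scaleR_2)
    then show "v \<in> V"
      using p(2)[of v] by simp
  next
    assume "v \<in> V"
    then have "p v = v" by (intro uniq) auto
    then show "R v = - v" by (simp add: R_def scaleR_2)
  qed
  have fixV: "R v = v \<longleftrightarrow> (\<forall>u\<in>V. u \<bullet> v = 0)" for v
  proof
    assume "R v = v"
    then have "p v = 0" by (simp add: R_def)
    then show "\<forall>u\<in>V. u \<bullet> v = 0" using p(3)[of _ v] by simp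
  next
    assume "\<forall>u\<in>V. u \<bullet> v = 0"
    then have "p v = 0" by (intro uniq) (use assms subspace_0 in auto)
    then show "R v = v" by (simp add: R_def)
  qed
  have "R (f x) = f (R x)" if f: "orthogonal_transformation f" and fV: "f ` V = V" for f x
  proof -
    have isom: "\<And>x y. f x \<bullet> f y = x \<bullet> y" and linf: "linear f"
      using f by (auto simp: orthogonal_transformation_def)
    have "p (f x) = f (p x)"
    proof (rule uniq)
      show "f (p x) \<in> V" using p(2) fV by blast
      fix u assume "u \<in> V"
      then obtain w where "w \<in> V" "u = f w" using fV by blast
      then show "u \<bullet> (f x - f (p x)) = 0"
        using p(3) isom by (simp flip: linear_diff[OF linf])
    qed
    then show ?thesis
      by (simp add: R_def linear_diff[OF linf] linear_scale[OF linf])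
  qed
  then show thesis
    using that R neg fixV by blast
qed

section \<open>Invariant planes and common eigenvalues\<close>

lemma mem_span_pair: "x \<in> span {a, b} \<longleftrightarrow> (\<exists>k l. x = k *\<^sub>R a + l *\<^sub>R b)"
proof -
  have "x \<in> span {a, b} \<longleftrightarrow> (\<exists>k l. x - k *\<^sub>R a = l *\<^sub>R b)"
    by (simp add: span_breakdown_eq[of x a] span_singleton image_iff)
  then show ?thesis
    by (simp add: diff_eq_eq add.commute)
qed

text \<open>The relation \<open>f (f w) = 2 c f w - w\<close> keeps \<open>f\<close> inside the
  plane; solved for \<open>w\<close>, it puts \<open>w\<close> into the image.\<close>

lemma rot_plane_image:
  assumes "linear f" and w: "w \<in> rot_space f c"
  shows "f ` span {w, f w} = span {w, f w}"
proof
  interpret f: linear f by (rule assms)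
  have ffw: "f (f w) = (2 * c) *\<^sub>R f w - w"
    using w by (simp add: rot_space_def algebra_simps)
  show "f ` span {w, f w} \<subseteq> span {w, f w}"
  proof -
    have "span (f ` {w, f w}) \<subseteq> span {w, f w}"
      by (rule span_minimal) (auto simp: ffw intro: span_base span_diff span_scale)
    then show ?thesis
      by (simp only: linear_span_image[OF assms(1)])
  qed
  show "span {w, f w} \<subseteq> f ` span {w, f w}"
  proof
    fix x assume "x \<in> span {w, f w}"
    then obtain k l where "x = k *\<^sub>R w + l *\<^sub>R f w"
      by (auto simp: mem_span_pair)
    moreover have "w = f ((2 * c) *\<^sub>R w - f w)"
      by (simp add: f.diff f.scale ffw)
    ultimately have "x = f (k *\<^sub>R ((2 * c) *\<^sub>R w - f w) + l *\<^sub>R w)"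
      by (simp add: f.add f.scale)
    moreover have "k *\<^sub>R ((2 * c) *\<^sub>R w - f w) + l *\<^sub>R w \<in> span {w, f w}"
      by (intro span_add span_scale span_diff) (auto intro: span_base)
    ultimately show "x \<in> f ` span {w, f w}" by blast
  qed
qed

text \<open>Applying the bijection \<open>g\<close> to the right-hand equation gives the defining
  one. In this form the pieces are eigenspaces of a symmetric operator.\<close>

lemma rot_space_inv:
  fixes g :: "'a::euclidean_space \<Rightarrow> 'a"
  assumes "orthogonal_transformation g"
  shows "v \<in> rot_space g d \<longleftrightarrow> g v + inv g v = (2 * d) *\<^sub>R v"
proof -
  have bij: "bij g" and lin: "linear g"
    using assms orthogonal_transformation_bij orthogonal_transformation_def by blast+
  have "g v + inv g v = (2 * d) *\<^sub>R v \<longleftrightarrow> g (g v + inv g v) = g ((2 * d) *\<^sub>R v)"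
    using bij by (metis bij_def injD)
  also have "\<dots> \<longleftrightarrow> v \<in> rot_space g d"
    using bij by (simp add: linear_add[OF lin] linear_scale[OF lin] rot_space_def
        surj_f_inv_f bij_is_surj)
  finally show ?thesis by simp
qed

text \<open>Vectors \<open>u\<close> and \<open>w\<close> with different eigenvalues are orthogonal
  by symmetry. Pairing the eigenvector equation of \<open>u + w\<close> with \<open>u\<close> then
  gives \<open>m = k\<close>, which forces \<open>S w = k w\<close>.\<close>

lemma common_eigenvalue:
  fixes S :: "'a::real_inner \<Rightarrow> 'a"
  assumes "linear S" and sym: "\<And>x y. S x \<bullet> y = x \<bullet> S y" and "subspace W"
    and eig: "\<And>w. w \<in> W \<Longrightarrow> \<exists>k. S w = k *\<^sub>R w"
  obtains k where "\<And>w. w \<in> W \<Longrightarrow> S w = k *\<^sub>R w"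
proof (cases "\<exists>u\<in>W. u \<noteq> 0")
  case False
  then have "S w = 0 *\<^sub>R w" if "w \<in> W" for w
    using that linear_0[OF assms(1)] by auto
  then show thesis using that by blast
next
  case True
  then obtain u k where u: "u \<in> W" "u \<noteq> 0" "S u = k *\<^sub>R u"
    using eig by blast
  have "S w = k *\<^sub>R w" if w: "w \<in> W" for w
  proof -
    obtain l where l: "S w = l *\<^sub>R w" using eig w by blast
    obtain m where m: "S (u + w) = m *\<^sub>R (u + w)"
      using eig subspace_add[OF assms(3) u(1) w] by blast
    show ?thesis
    proof (cases "k = l")
      case False
      have "k * (u \<bullet> w) = l * (u \<bullet> w)"
        using sym[of u w] u l by simp
      then have orth: "u \<bullet> w = 0" using False by simp
      have eq: "k *\<^sub>R u + l *\<^sub>R w = m *\<^sub>R u + m *\<^sub>R w"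
        using m u l linear_add[OF assms(1)] by (simp add: scaleR_add_right)
      have "k * (u \<bullet> u) = m * (u \<bullet> u)"
        using arg_cong[OF eq, of "\<lambda>x. u \<bullet> x"] orth by (simp add: inner_add_right)
      then have "k = m" using u by simp
      then show ?thesis using eq l by simp
    qed (use l in simp)
  qed
  then show thesis using that by blast
qed

text \<open>The half-turn in the plane spanned by \<open>w\<close> and \<open>f w\<close> commutes with \<open>f\<close>, hence with \<open>g\<close>, so
  \<open>g\<close> preserves that plane; comparing with the skew direction \<open>f w - c w\<close> shows that \<open>w\<close> is an
  eigenvector of \<open>g\<close> plus its inverse.\<close>
lemma rot_space_subset:
  fixes f g :: "'a::euclidean_space \<Rightarrow> 'a"
  assumes f: "orthogonal_transformation f" and g: "orthogonal_transformation g"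
    and comm: "\<And>B x. orthogonal_transformation B \<Longrightarrow> (\<And>x. B (f x) = f (B x)) \<Longrightarrow>
                 (\<And>x. f x = x \<Longrightarrow> B x = x) \<Longrightarrow> B (g x) = g (B x)"
    and fg: "\<And>x. f (g x) = g (f x)"
    and fix_iff: "\<And>x. f x = x \<longleftrightarrow> g x = x"
    and c: "c \<noteq> 1"
  obtains d where "d \<noteq> 1" "rot_space f c \<subseteq> rot_space g d" "c = -1 \<Longrightarrow> d = -1"
proof (cases "rot_space f c = {0}")
  case True
  then show thesis
    using that[of c] c zero_in_rot_space[of g c] g by (auto simp: orthogonal_transformation_def)
next
  case nontriv: False
  have linf: "linear f" and isof: "\<And>x y. f x \<bullet> f y = x \<bullet> y"
    and ling: "linear g" and isog: "\<And>x y. g x \<bullet> g y = x \<bullet> y"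
    using f g by (auto simp: orthogonal_transformation_def)
  have invg: "g (inv g x) = x" and invg': "inv g (g x) = x" for x
    using g by (auto simp: orthogonal_transformation_surj orthogonal_transformation_inj surj_f_inv_f)
  have lini: "linear (inv g)"
    using g orthogonal_transformation_inv orthogonal_transformation_linear by blast
  obtain w0 where w0: "w0 \<in> rot_space f c" "w0 \<noteq> 0"
    using nontriv rot_space_nontrivial[OF linf] by blast
  have plane: "g v \<in> span {w, f w}" "inv g v \<in> span {w, f w}"
    if w: "w \<in> rot_space f c" and v: "v \<in> span {w, f w}" for v w
  proof -
    obtain R where R: "orthogonal_transformation R" "\<And>v. R v = - v \<longleftrightarrow> v \<in> span {w, f w}"
      and fixR: "\<And>v. R v = v \<longleftrightarrow> (\<forall>u\<in>span {w, f w}. u \<bullet> v = 0)"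
      and commR: "\<And>f' x. orthogonal_transformation f' \<Longrightarrow> f' ` span {w, f w} = span {w, f w} \<Longrightarrow> R (f' x) = f' (R x)"
      by (rule reflection_exists[OF subspace_span[of "{w, f w}"]]) (rule that)
    \<comment> \<open>The fixed vectors of \<open>f\<close> form the piece for \<open>1\<close>,
      which is orthogonal to the plane because \<open>c\<close> is not \<open>1\<close>. Hence
      \<open>R\<close> is an admissible \<open>B\<close> in \<open>comm\<close>.\<close>
    have "R x = x" if "f x = x" for x
    proof -
      have x: "x \<in> rot_space f 1" using that f by (simp add: rot_space_one)
      have "w \<bullet> x = 0" "f w \<bullet> x = 0"
        using rot_space_orthogonal[OF f _ x c] w rot_space_closed[OF linf] by auto
      then show ?thesis
        unfolding fixR by (auto simp: mem_span_pair inner_add_left)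
    qed
    then have Rg: "R (g x) = g (R x)" for x
      by (rule comm[OF R(1) commR[OF f rot_plane_image[OF linf w]]])
    have "R v = - v" using R v by blast
    then show "g v \<in> span {w, f w}"
      using Rg[of v] R(2)[of "g v"] by (simp add: linear_neg[OF ling])
    have "R (inv g v) = inv g (R v)"
      using Rg[of "inv g v"] by (metis invg invg')
    then show "inv g v \<in> span {w, f w}"
      using \<open>R v = - v\<close> R(2)[of "inv g v"] by (simp add: linear_neg[OF lini])
  qed
  define S where "S x = g x + inv g x" for x
  have linS: "linear S"
    unfolding S_def using ling lini by (intro linear_compose_add)
  have adj: "inv g x \<bullet> y = x \<bullet> g y" for x y
    by (metis invg isog)
  have symS: "S x \<bullet> y = x \<bullet> S y" for x y
    using adj[of x y] adj[of y x] by (simp add: S_def inner_add_left inner_add_right inner_commute)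
  have fS: "f (S x) = S (f x)" for x
  proof -
    have "f (inv g x) = inv g (f x)" using fg[of "inv g x"] by (metis invg invg')
    then show ?thesis by (simp add: S_def linear_add[OF linf] fg)
  qed
  have eig: "\<exists>k. S w = k *\<^sub>R w" if w: "w \<in> rot_space f c" for w
  proof -
    have "S w \<in> span {w, f w}"
      unfolding S_def by (rule span_add[OF plane(1)[OF w] plane(2)[OF w]]) (auto intro: span_base)
    then obtain a b where ab: "S w = a *\<^sub>R w + b *\<^sub>R f w"
      by (auto simp: mem_span_pair)
    define k where "k = f w - c *\<^sub>R w"
    have kw: "w \<bullet> k = 0"
      using rot_space_inner[OF f w] by (simp add: k_def inner_diff_right inner_commute)
    obtain z where z: "z = (2 * c) *\<^sub>R w - f w" "f z = w"
      using rot_space_preimage[OF linf w] by blast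
    \<comment> \<open>Symmetry of \<open>S\<close> and its commutation with \<open>f\<close> give
      \<open>f w \<bullet> S w = c * (w \<bullet> S w)\<close>. So \<open>S w\<close> is orthogonal
      to \<open>k\<close>, and its component \<open>b *\<^sub>R k\<close> vanishes.\<close>
    have "f w \<bullet> S w = S (f w) \<bullet> w" by (simp add: symS)
    also have "\<dots> = f (S w) \<bullet> f z" by (simp add: fS z(2))
    also have "\<dots> = S w \<bullet> z" by (simp only: isof)
    also have "\<dots> = 2 * c * (w \<bullet> S w) - f w \<bullet> S w"
      unfolding z(1) by (simp add: inner_diff_right inner_commute)
    finally have "k \<bullet> S w = 0" by (simp add: k_def inner_diff_left)
    moreover have Sw: "S w = (a + b * c) *\<^sub>R w + b *\<^sub>R k"
      by (simp add: ab k_def algebra_simps)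
    ultimately have "b * (k \<bullet> k) = 0"
      using kw by (simp add: inner_add_right inner_commute)
    then have "b *\<^sub>R k = 0" by auto
    then show ?thesis using Sw by auto
  qed
  obtain e where e: "\<And>w. w \<in> rot_space f c \<Longrightarrow> S w = e *\<^sub>R w"
    using common_eigenvalue[OF linS symS subspace_rot_space[OF linf] eig] by blast
  have sub: "rot_space f c \<subseteq> rot_space g (e / 2)"
    using e by (auto simp: rot_space_inv[OF g] S_def)
  have "\<not> g w0 = w0"
    using rot_space_disjoint[OF f w0(1) _ w0(2), of 1] c
    by (auto simp: rot_space_one[OF f] simp flip: fix_iff)
  then have "e / 2 \<noteq> 1"
    using sub w0 rot_space_one[OF g] by auto
  \<comment> \<open>For \<open>c = -1\<close> the plane degenerates to the line of
    \<open>w0\<close>, so \<open>g w0\<close> is \<open>w0\<close> or \<open>- w0\<close>; the first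
    is excluded because \<open>f\<close> and \<open>g\<close> have the same fixed vectors.\<close>
  moreover have "e / 2 = -1" if "c = -1"
  proof -
    have fw0: "f w0 = - w0" using w0 that rot_space_minus_one[OF f] by auto
    then obtain k l where "g w0 = k *\<^sub>R w0 + l *\<^sub>R f w0"
      using plane(1)[OF w0(1) span_base[of w0]] by (auto simp: mem_span_pair)
    then have gw: "g w0 = (k - l) *\<^sub>R w0" by (simp add: fw0 algebra_simps)
    have "norm (g w0) = norm w0" using g by (simp add: orthogonal_transformation)
    then have "\<bar>k - l\<bar> = 1" using gw w0 by simp
    then have "k - l = -1"
      using \<open>g w0 \<noteq> w0\<close> gw by (cases "k - l = 1") auto
    then have "w0 \<in> rot_space g (-1)"
      using gw by (simp add: rot_space_minus_one[OF g])
    then show ?thesis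
      using rot_space_disjoint[OF g] sub w0 by blast
  qed
  ultimately show thesis
    using that sub by blast
qed

text \<open>These are the real dimensions of the complex pieces; the pieces for \<open>1\<close> and
  \<open>-1\<close> are recorded separately. For matrices each entry is twice an entry of
  \<open>segre_nonreal\<close>.\<close>

definition rot_dims :: "('a::euclidean_space \<Rightarrow> 'a) \<Rightarrow> nat multiset" where
  "rot_dims f =
     image_mset (\<lambda>c. dim (rot_space f c)) (mset_set {c. \<bar>c\<bar> < 1 \<and> rot_space f c \<noteq> {0}})"

text \<open>Different indices of nontrivial pieces give different subspaces, so the multiset depends
  only on the set of pieces. Two maps with the same pieces have the same \<open>rot_dims\<close>
  even if their angles differ.\<close>

lemma rot_dims_eq_image:
  assumes f: "orthogonal_transformation f"
  shows "rot_dims f = image_mset dim (mset_set (rot_space f ` {c. \<bar>c\<bar> < 1 \<and> rot_space f c \<noteq> {0}}))"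
proof -
  have "inj_on (rot_space f) {c. \<bar>c\<bar> < 1 \<and> rot_space f c \<noteq> {0}}"
  proof (rule inj_onI, clarify)
    fix c d assume "rot_space f c \<noteq> {0}" and eq: "rot_space f c = rot_space f d"
    then obtain v where "v \<in> rot_space f c" "v \<noteq> 0"
      using rot_space_nontrivial[of f c] f by (auto simp: orthogonal_transformation_def)
    then show "c = d" using rot_space_disjoint[OF f] eq by blast
  qed
  then show ?thesis
    by (simp add: rot_dims_def multiset.map_comp comp_def flip: image_mset_mset_set)
qed

text \<open>Reduction to \<open>rot_space_subset\<close>: \<open>B = f\<close> in
  \<open>same\<close> shows that \<open>f\<close> and \<open>g\<close> commute, and a
  \<open>B\<close> that commutes with \<open>f\<close> and fixes all its fixed vectors fixes
  \<open>a\<close>, so \<open>same\<close> applies to it.\<close>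

lemma rot_spaces_subset:
  fixes f g :: "'a::euclidean_space \<Rightarrow> 'a"
  assumes f: "orthogonal_transformation f" and g: "orthogonal_transformation g"
    and a: "f a = a" and b: "g b = b"
    and same: "\<forall>B. orthogonal_transformation B \<longrightarrow>
      ((\<forall>x. B (f x) = f (B x)) \<and> B a = a \<longleftrightarrow> (\<forall>x. B (g x) = g (B x)) \<and> B b = b)"
    and fix_iff: "\<And>x. f x = x \<longleftrightarrow> g x = x"
    and c: "c \<noteq> 1"
  obtains d where "d \<noteq> 1" "rot_space f c \<subseteq> rot_space g d" "c = -1 \<Longrightarrow> d = -1"
proof (rule rot_space_subset[OF f g _ _ fix_iff c])
  show "f (g x) = g (f x)" for x
    using same f a by blast
  show "B (g x) = g (B x)"
    if "orthogonal_transformation B" "\<And>x. B (f x) = f (B x)" "\<And>x. f x = x \<Longrightarrow> B x = x" for B x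
    using same that a by blast
qed (use that in blast)

text \<open>The inclusions of \<open>rot_spaces_subset\<close> hold in both directions. Composed,
  they return a nontrivial piece to itself, so both are equalities; the angles may differ, and only
  the sets of pieces are compared.\<close>

lemma rot_spaces_eq:
  fixes f g :: "'a::euclidean_space \<Rightarrow> 'a"
  assumes f: "orthogonal_transformation f" and g: "orthogonal_transformation g"
    and a: "f a = a" and b: "g b = b"
    and same: "\<forall>B. orthogonal_transformation B \<longrightarrow>
      ((\<forall>x. B (f x) = f (B x)) \<and> B a = a \<longleftrightarrow> (\<forall>x. B (g x) = g (B x)) \<and> B b = b)"
    and fix_iff: "\<And>x. f x = x \<longleftrightarrow> g x = x"
  shows "rot_space f (-1) = rot_space g (-1)" and "rot_dims f = rot_dims g"
proof -
  have same': "\<forall>B. orthogonal_transformation B \<longrightarrow>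
      ((\<forall>x. B (g x) = g (B x)) \<and> B b = b \<longleftrightarrow> (\<forall>x. B (f x) = f (B x)) \<and> B a = a)"
    using same by blast
  have s: "\<exists>d. d \<noteq> 1 \<and> rot_space f c \<subseteq> rot_space g d \<and> (c = -1 \<longrightarrow> d = -1)" if "c \<noteq> 1" for c
    by (rule rot_spaces_subset[OF f g a b same fix_iff that]) blast
  have s': "\<exists>d. d \<noteq> 1 \<and> rot_space g c \<subseteq> rot_space f d \<and> (c = -1 \<longrightarrow> d = -1)" if "c \<noteq> 1" for c
    by (rule rot_spaces_subset[OF g f b a same' fix_iff[symmetric] that]) blast
  show "rot_space f (-1) = rot_space g (-1)"
    using s[of "-1"] s'[of "-1"] by auto
  \<comment> \<open>Stated for variable maps to serve both inclusions. The clause on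
    \<open>-1\<close> rules out \<open>d = -1\<close>, which would give \<open>c' = -1\<close>
    although \<open>c' = c\<close>.\<close>
  have *: "\<exists>d. \<bar>d\<bar> < 1 \<and> rot_space f' c = rot_space g' d"
    if c: "\<bar>c\<bar> < 1" and nt: "rot_space f' c \<noteq> {0}"
      and f': "orthogonal_transformation f'" and g': "orthogonal_transformation g'"
      and s: "\<And>c. c \<noteq> 1 \<Longrightarrow> \<exists>d. d \<noteq> 1 \<and> rot_space f' c \<subseteq> rot_space g' d \<and> (c = -1 \<longrightarrow> d = -1)"
      and s': "\<And>d. d \<noteq> 1 \<Longrightarrow> \<exists>c. c \<noteq> 1 \<and> rot_space g' d \<subseteq> rot_space f' c \<and> (d = -1 \<longrightarrow> c = -1)"
    for f' g' :: "'a \<Rightarrow> 'a" and c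
  proof -
    obtain v where v: "v \<in> rot_space f' c" "v \<noteq> 0"
      using rot_space_nontrivial[of f' c] f' nt by (auto simp: orthogonal_transformation_def)
    have "c \<noteq> 1" "c \<noteq> -1" using c by auto
    then obtain d where d: "d \<noteq> 1" "rot_space f' c \<subseteq> rot_space g' d" using s by blast
    then obtain c' where c': "rot_space g' d \<subseteq> rot_space f' c'" "d = -1 \<Longrightarrow> c' = -1"
      using s' by blast
    have "c' = c"
      using rot_space_disjoint[OF f'] v d c' by blast
    then have "rot_space f' c = rot_space g' d" "d \<noteq> -1"
      using d c' \<open>c \<noteq> -1\<close> by auto
    moreover have "\<bar>d\<bar> \<le> 1"
      using rot_space_bound[OF g', of v d] v d by blast
    ultimately show ?thesis
      using d by (intro exI[of _ d]) auto
  qed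
  have "rot_space f ` {c. \<bar>c\<bar> < 1 \<and> rot_space f c \<noteq> {0}} = rot_space g ` {c. \<bar>c\<bar> < 1 \<and> rot_space g c \<noteq> {0}}"
  proof (intro subset_antisym subsetI; clarify)
    fix c assume c: "\<bar>c\<bar> < 1" "rot_space f c \<noteq> {0}"
    obtain d where "\<bar>d\<bar> < 1" "rot_space f c = rot_space g d"
      using *[OF c f g s s'] by blast
    then show "rot_space f c \<in> rot_space g ` {c. \<bar>c\<bar> < 1 \<and> rot_space g c \<noteq> {0}}"
      using c by auto
  next
    fix c assume c: "\<bar>c\<bar> < 1" "rot_space g c \<noteq> {0}"
    obtain d where "\<bar>d\<bar> < 1" "rot_space g c = rot_space f d"
      using *[OF c g f s' s] by blast
    then show "rot_space g c \<in> rot_space f ` {c. \<bar>c\<bar> < 1 \<and> rot_space f c \<noteq> {0}}"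
      using c by auto
  qed
  then show "rot_dims f = rot_dims g"
    using f g by (simp add: rot_dims_eq_image)
qed

section \<open>Invariance under orthogonal conjugation\<close>

lemma rot_space_conj:
  fixes P :: "'a::euclidean_space \<Rightarrow> 'a"
  assumes P: "orthogonal_transformation P" and conj: "\<And>x. P (g x) = f (P x)"
  shows "rot_space f c = P ` rot_space g c"
proof -
  have lin: "linear P" and "surj P" and inj: "inj P"
    using P orthogonal_transformation_linear orthogonal_transformation_surj
      orthogonal_transformation_inj by blast+
  have "P v \<in> rot_space f c \<longleftrightarrow> v \<in> rot_space g c" for v
  proof -
    have "P v \<in> rot_space f c \<longleftrightarrow> P (g (g v) + v) = P ((2 * c) *\<^sub>R g v)"
      by (simp add: rot_space_def linear_add[OF lin] linear_scale[OF lin] conj)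
    then show ?thesis
      by (simp add: rot_space_def inj_eq[OF inj])
  qed
  then show ?thesis
    using \<open>surj P\<close> by (auto simp: surj_def image_iff) metis
qed

lemma dim_orthogonal_image:
  fixes P :: "'a::euclidean_space \<Rightarrow> 'a"
  assumes "orthogonal_transformation P"
  shows "dim (P ` S) = dim S"
  using assms orthogonal_transformation_inj orthogonal_transformation_linear
  by (intro dim_image_eq) (auto intro: inj_on_subset)

lemma rot_dims_conj:
  fixes P :: "'a::euclidean_space \<Rightarrow> 'a"
  assumes P: "orthogonal_transformation P" and conj: "\<And>x. P (g x) = f (P x)" and "linear f" "linear g"
  shows "rot_dims f = rot_dims g"
proof -
  have d: "dim (rot_space f c) = dim (rot_space g c)" for c
    by (simp add: rot_space_conj[where P = P and g = g and f = f, OF P conj] dim_orthogonal_image[OF P])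
  have "rot_space f c = {0} \<longleftrightarrow> rot_space g c = {0}" for c
    using d[of c] zero_in_rot_space[of f c] zero_in_rot_space[of g c] assms(3,4)
      dim_eq_0[of "rot_space f c"] dim_eq_0[of "rot_space g c"] by auto
  then show ?thesis
    by (simp add: rot_dims_def d)
qed

section \<open>Gluing isometries\<close>

lemma isometry_on_inner:
  fixes T :: "'a::euclidean_space \<Rightarrow> 'a"
  assumes "linear T" "subspace V" "\<And>v. v \<in> V \<Longrightarrow> norm (T v) = norm v" "x \<in> V" "y \<in> V"
  shows "T x \<bullet> T y = x \<bullet> y"
  using assms(3)[OF subspace_add[OF assms(2,4,5)]] assms(3)[OF assms(4)] assms(3)[OF assms(5)]
  by (simp add: dot_norm linear_add[OF assms(1)])

text \<open>Preservation of norms makes \<open>T\<close> injective on \<open>V\<close>, and equal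
  dimensions give surjectivity.\<close>

lemma isometry_on_image:
  fixes T :: "'a::euclidean_space \<Rightarrow> 'a"
  assumes "linear T" "subspace V" "subspace V'" "T ` V \<subseteq> V'" "dim V = dim V'"
    and norm: "\<And>v. v \<in> V \<Longrightarrow> norm (T v) = norm v"
  shows "T ` V = V'"
proof (rule subspace_dim_equal)
  have "inj_on T V"
    using linear_injective_on_subspace_0[OF assms(1,2)] norm by (metis norm_eq_zero)
  then have "dim (T ` V) = dim V"
    using assms by (intro dim_image_eq) (auto simp: span_eq_iff[THEN iffD2])
  then show "dim V' \<le> dim (T ` V)" using assms by simp
qed (use assms in \<open>auto intro: linear_subspace_image\<close>)

lemma norm_orthonormal_decomp:
  fixes u j z :: "'a::real_inner"
  assumes "norm u = 1" "norm j = 1" "u \<bullet> j = 0" "u \<bullet> z = 0" "j \<bullet> z = 0"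
  shows "(norm (a *\<^sub>R u + b *\<^sub>R j + z))\<^sup>2 = a\<^sup>2 + b\<^sup>2 + (norm z)\<^sup>2"
  using assms unfolding power2_norm_eq_inner
  by (simp add: inner_add_left inner_add_right inner_commute norm_eq_1 power2_eq_square)

text \<open>Induction splits off one complex line at a time: a unit vector \<open>u\<close> and
  \<open>J u\<close> are orthonormal, and their plane and its complement in \<open>V\<close> are
  preserved by \<open>J\<close>. \<open>T\<close> sends \<open>u\<close> to \<open>u'\<close> and
  \<open>J u\<close> to \<open>J' u'\<close> and is given by induction on the complement.\<close>

lemma complex_structure_isometry:
  fixes V V' :: "'a::euclidean_space set"
  assumes "linear J" "linear J'" "subspace V" "subspace V'" "J ` V \<subseteq> V" "J' ` V' \<subseteq> V'"
    and "\<And>v. v \<in> V \<Longrightarrow> J (J v) = - v" "\<And>v. v \<in> V \<Longrightarrow> norm (J v) = norm v"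
    and "\<And>v. v \<in> V' \<Longrightarrow> J' (J' v) = - v" "\<And>v. v \<in> V' \<Longrightarrow> norm (J' v) = norm v"
    and "dim V = dim V'"
  shows "\<exists>T. linear T \<and> T ` V \<subseteq> V' \<and> (\<forall>v\<in>V. norm (T v) = norm v) \<and> (\<forall>v\<in>V. T (J v) = J' (T v))"
  using assms(3-)
proof (induction "dim V" arbitrary: V V' rule: less_induct)
  case (less V V')
  \<comment> \<open>Proved for a general space and structure, since such a plane is needed in both
    \<open>V\<close> and \<open>V'\<close>. The last clause gives the coordinates of
    \<open>J v\<close> along \<open>u\<close> and \<open>J u\<close>.\<close>
  have split: "\<exists>u\<in>V. norm u = 1 \<and> norm (J u) = 1 \<and> u \<bullet> J u = 0 \<and>
      (let V2 = {y \<in> V. \<forall>x\<in>span {u, J u}. orthogonal x y}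
       in dim V2 + 2 = dim V \<and> subspace V2 \<and> J ` V2 \<subseteq> V2) \<and> (\<forall>v\<in>V. u \<bullet> J v = - (J u \<bullet> v) \<and> J u \<bullet> J v = u \<bullet> v)"
    if V: "subspace V" "J ` V \<subseteq> V" "dim V \<noteq> 0" and lin: "linear J"
      and JJ: "\<And>v. v \<in> V \<Longrightarrow> J (J v) = - v" and nJ: "\<And>v. v \<in> V \<Longrightarrow> norm (J v) = norm v"
    for V and J :: "'a \<Rightarrow> 'a"
  proof -
    obtain w where w: "w \<in> V" "w \<noteq> 0"
      using V(3) by (auto simp: dim_eq_0)
    define u where "u = w /\<^sub>R norm w"
    have u: "u \<in> V" "norm u = 1"
      using w V(1) by (auto simp: u_def intro: subspace_scale)
    have Ju: "J u \<in> V" "norm (J u) = 1"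
      using u V nJ by auto
    have inner: "J x \<bullet> J y = x \<bullet> y" if "x \<in> V" "y \<in> V" for x y
      using isometry_on_inner[OF lin V(1) nJ that] .
    \<comment> \<open>An isometry with square \<open>-1\<close> is skew; at \<open>v = u\<close>
      this makes \<open>u\<close> orthogonal to \<open>J u\<close>.\<close>
    have skew: "u \<bullet> J v = - (J u \<bullet> v)" if "v \<in> V" for v
      using inner[OF u(1), of "J v"] that V JJ[OF that] by auto
    have "u \<bullet> J u = 0"
      using skew[OF u(1)] by (simp add: inner_commute)
    have uJ: "u \<noteq> J u"
      using \<open>u \<bullet> J u = 0\<close> u by (metis norm_eq_1 zero_neq_one)
    have "independent {u, J u}"
      by (rule pairwise_orthogonal_independent)
        (use u Ju \<open>u \<bullet> J u = 0\<close> in \<open>auto simp: pairwise_def orthogonal_def inner_commute\<close>)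
    then have "dim (span {u, J u}) = 2"
      using uJ by (simp add: dim_eq_card_independent)
    moreover have "span {u, J u} \<subseteq> V"
      using u Ju V by (intro span_minimal) auto
    ultimately have d: "dim {y \<in> V. \<forall>x\<in>span {u, J u}. orthogonal x y} + 2 = dim V"
      using dim_subspace_orthogonal_to_vectors[OF subspace_span V(1)] by metis
    have mem: "y \<in> {y \<in> V. \<forall>x\<in>span {u, J u}. orthogonal x y} \<longleftrightarrow> y \<in> V \<and> u \<bullet> y = 0 \<and> J u \<bullet> y = 0" for y
    proof -
      have "(\<forall>x\<in>span {u, J u}. orthogonal x y) \<longleftrightarrow> u \<bullet> y = 0 \<and> J u \<bullet> y = 0"
        by (auto simp: orthogonal_def mem_span_pair inner_add_left intro: span_base)
      then show ?thesis by simp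
    qed
    have eq: "{y \<in> V. \<forall>x\<in>span {u, J u}. orthogonal x y} = {y \<in> V. u \<bullet> y = 0 \<and> J u \<bullet> y = 0}"
      using mem by blast
    have s: "subspace {y \<in> V. \<forall>x\<in>span {u, J u}. orthogonal x y}"
      unfolding subspace_def eq using V(1)
      by (auto simp: inner_add_right subspace_add subspace_scale subspace_0)
    have i: "J ` {y \<in> V. \<forall>x\<in>span {u, J u}. orthogonal x y} \<subseteq> {y \<in> V. \<forall>x\<in>span {u, J u}. orthogonal x y}"
    proof (rule image_subsetI)
      fix y assume "y \<in> {y \<in> V. \<forall>x\<in>span {u, J u}. orthogonal x y}"
      then show "J y \<in> {y \<in> V. \<forall>x\<in>span {u, J u}. orthogonal x y}"
        unfolding mem using skew[of y] inner[OF u(1), of y] V by auto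
    qed
    show ?thesis
      unfolding Let_def using u Ju \<open>u \<bullet> J u = 0\<close> d s i skew inner[OF u(1)]
      by (intro bexI[of _ u] conjI ballI) auto
  qed
  show ?case
  proof (cases "dim V = 0")
    case True
    then have "V \<subseteq> {0}" by simp
    moreover have "V' \<subseteq> {0}" using True less.prems by simp
    ultimately show ?thesis
      using subspace_0[OF less.prems(2)] linear_0[OF assms(1)] linear_0[OF assms(2)]
      by (intro exI[of _ "\<lambda>_. 0"]) (auto simp: linear_zero subset_singleton_iff)
  next
    case False
    obtain u where u: "u \<in> V" "norm u = 1" "norm (J u) = 1" "u \<bullet> J u = 0"
        "\<And>v. v \<in> V \<Longrightarrow> u \<bullet> J v = - (J u \<bullet> v)" "\<And>v. v \<in> V \<Longrightarrow> J u \<bullet> J v = u \<bullet> v"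
      and V2: "dim {y \<in> V. \<forall>x\<in>span {u, J u}. orthogonal x y} + 2 = dim V"
        "subspace {y \<in> V. \<forall>x\<in>span {u, J u}. orthogonal x y}"
        "J ` {y \<in> V. \<forall>x\<in>span {u, J u}. orthogonal x y} \<subseteq> {y \<in> V. \<forall>x\<in>span {u, J u}. orthogonal x y}"
      using split[OF less.prems(1,3) False assms(1) less.prems(5,6)] unfolding Let_def by blast
    have False': "dim V' \<noteq> 0" using False less.prems by simp
    obtain u' where u': "u' \<in> V'" "norm u' = 1" "norm (J' u') = 1" "u' \<bullet> J' u' = 0"
      and V2': "dim {y \<in> V'. \<forall>x\<in>span {u', J' u'}. orthogonal x y} + 2 = dim V'"
        "subspace {y \<in> V'. \<forall>x\<in>span {u', J' u'}. orthogonal x y}"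
        "J' ` {y \<in> V'. \<forall>x\<in>span {u', J' u'}. orthogonal x y} \<subseteq> {y \<in> V'. \<forall>x\<in>span {u', J' u'}. orthogonal x y}"
      using split[OF less.prems(2,4) False' assms(2) less.prems(7,8)] unfolding Let_def by blast
    define W where "W = {y \<in> V. \<forall>x\<in>span {u, J u}. orthogonal x y}"
    define W' where "W' = {y \<in> V'. \<forall>x\<in>span {u', J' u'}. orthogonal x y}"
    have "\<exists>T. linear T \<and> T ` W \<subseteq> W' \<and> (\<forall>v\<in>W. norm (T v) = norm v) \<and> (\<forall>v\<in>W. T (J v) = J' (T v))"
      by (rule less.hyps) (use V2 V2' less.prems in \<open>auto simp flip: W_def W'_def\<close>,
          auto simp: W_def W'_def less.prems)
    then obtain S where S: "linear S" "\<And>v. v \<in> W \<Longrightarrow> S v \<in> W'" "\<And>v. v \<in> W \<Longrightarrow> norm (S v) = norm v"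
      "\<And>v. v \<in> W \<Longrightarrow> S (J v) = J' (S v)" by blast
    have memW: "y \<in> W \<longleftrightarrow> y \<in> V \<and> u \<bullet> y = 0 \<and> J u \<bullet> y = 0" for y
      by (auto simp: W_def orthogonal_def mem_span_pair inner_add_left intro: span_base)
    have memW': "y \<in> W' \<Longrightarrow> y \<in> V' \<and> u' \<bullet> y = 0 \<and> J' u' \<bullet> y = 0" for y
      by (auto simp: W'_def orthogonal_def intro: span_base)
    have JuV: "J u \<in> V" and JuV': "J' u' \<in> V'" using u(1) u'(1) less.prems by auto
    \<comment> \<open>On \<open>V\<close>, \<open>q\<close> is the projection onto the complement
      \<open>W\<close>; \<open>T\<close> copies the two plane coordinates and applies
      \<open>S\<close> to the rest.\<close>
    define q where "q v = v - (u \<bullet> v) *\<^sub>R u - (J u \<bullet> v) *\<^sub>R J u" for v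
    define T where "T v = (u \<bullet> v) *\<^sub>R u' + (J u \<bullet> v) *\<^sub>R J' u' + S (q v)" for v
    have linq: "linear q"
      by (rule linearI) (auto simp: q_def inner_add_right algebra_simps)
    have linT: "linear T"
      by (rule linearI) (auto simp: T_def linear_add[OF linq] linear_scale[OF linq]
          linear_add[OF S(1)] linear_scale[OF S(1)] inner_add_right algebra_simps)
    have qW: "q v \<in> W" if "v \<in> V" for v
      unfolding memW
      using that u(1-4) JuV \<open>subspace V\<close>
      by (auto simp: q_def inner_diff_right norm_eq_1 inner_commute intro!: subspace_diff subspace_scale)
    have Tmem: "T v \<in> V'" if "v \<in> V" for v
      unfolding T_def using that qW[OF that] S(2) memW' u'(1) JuV' \<open>subspace V'\<close>
      by (intro subspace_add subspace_scale) auto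
    have Tnorm: "norm (T v) = norm v" if "v \<in> V" for v
    proof -
      have "(norm (T v))\<^sup>2 = (u \<bullet> v)\<^sup>2 + (J u \<bullet> v)\<^sup>2 + (norm (S (q v)))\<^sup>2"
        unfolding T_def using u' memW'[OF S(2)[OF qW[OF that]]] by (intro norm_orthonormal_decomp) auto
      also have "\<dots> = (u \<bullet> v)\<^sup>2 + (J u \<bullet> v)\<^sup>2 + (norm (q v))\<^sup>2"
        using S(3) qW that by simp
      also have "\<dots> = (norm ((u \<bullet> v) *\<^sub>R u + (J u \<bullet> v) *\<^sub>R J u + q v))\<^sup>2"
        using u qW[OF that] memW by (intro norm_orthonormal_decomp[symmetric]) auto
      also have "(u \<bullet> v) *\<^sub>R u + (J u \<bullet> v) *\<^sub>R J u + q v = v"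
        by (simp add: q_def)
      finally show ?thesis by simp
    qed
    have TJ: "T (J v) = J' (T v)" if "v \<in> V" for v
    proof -
      have "q (J v) = J (q v)"
        using u(5,6)[OF that] less.prems(5)[OF u(1)]
        by (simp add: q_def linear_diff[OF assms(1)] linear_scale[OF assms(1)])
      then show ?thesis
        using u(5,6)[OF that] less.prems(7)[OF u'(1)] S(4)[OF qW[OF that]]
        by (simp add: T_def linear_add[OF assms(2)] linear_scale[OF assms(2)])
    qed
    show ?thesis
      using linT Tmem Tnorm TJ by blast
  qed
qed

text \<open>\<open>P\<close> is the sum of the \<open>T i\<close> composed with the projections onto
  \<open>X i\<close>. Inner products are preserved between vectors of the pieces, then on the span
  by linearity in one argument at a time.\<close>

lemma glue_isometries:
  fixes X Y :: "'i \<Rightarrow> 'a::euclidean_space set"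
  assumes "finite I" and X: "\<And>i. i \<in> I \<Longrightarrow> subspace (X i)"
    and orthX: "\<And>i j x y. \<lbrakk>i \<in> I; j \<in> I; i \<noteq> j; x \<in> X i; y \<in> X j\<rbrakk> \<Longrightarrow> x \<bullet> y = 0"
    and orthY: "\<And>i j x y. \<lbrakk>i \<in> I; j \<in> I; i \<noteq> j; x \<in> Y i; y \<in> Y j\<rbrakk> \<Longrightarrow> x \<bullet> y = 0"
    and span: "span (\<Union>i\<in>I. X i) = UNIV"
    and T: "\<And>i. i \<in> I \<Longrightarrow> linear (T i)" "\<And>i. i \<in> I \<Longrightarrow> T i ` X i \<subseteq> Y i"
      "\<And>i v. i \<in> I \<Longrightarrow> v \<in> X i \<Longrightarrow> norm (T i v) = norm v"
  obtains P where "orthogonal_transformation P" "\<And>i v. i \<in> I \<Longrightarrow> v \<in> X i \<Longrightarrow> P v = T i v"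
proof -
  have "\<exists>p. linear p \<and> (\<forall>v y. y \<in> X i \<longrightarrow> (\<forall>u\<in>X i. u \<bullet> (v - y) = 0) \<longrightarrow> p v = y)"
    if "i \<in> I" for i
    by (rule orthogonal_projection_exists[OF X[OF that]]) blast
  then obtain p where p: "\<And>i. i \<in> I \<Longrightarrow> linear (p i)"
    and uniq: "\<And>i v y. \<lbrakk>i \<in> I; y \<in> X i; \<forall>u\<in>X i. u \<bullet> (v - y) = 0\<rbrakk> \<Longrightarrow> p i v = y"
    by metis
  define P where "P v = (\<Sum>i\<in>I. T i (p i v))" for v
  have lin: "linear P"
    unfolding P_def
  proof (rule linear_compose_sum, rule ballI)
    fix i assume "i \<in> I"
    then show "linear (\<lambda>v. T i (p i v))"
      using linear_compose[OF p T(1)] by (simp add: comp_def)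
  qed
  have PT: "P v = T i v" if "i \<in> I" "v \<in> X i" for i v
  proof -
    have "T j (p j v) = (if j = i then T i v else 0)" if "j \<in> I" for j
    proof (cases "j = i")
      case True
      then show ?thesis using uniq[of i v v] \<open>i \<in> I\<close> \<open>v \<in> X i\<close> by simp
    next
      case False
      then have "p j v = 0"
        using that \<open>i \<in> I\<close> \<open>v \<in> X i\<close> orthX[of j i _ v] subspace_0[OF X] by (intro uniq) auto
      then show ?thesis using False linear_0[OF T(1)] that by simp
    qed
    then have "P v = (\<Sum>j\<in>I. if j = i then T i v else 0)"
      by (simp add: P_def)
    then show ?thesis using \<open>finite I\<close> \<open>i \<in> I\<close> by simp
  qed
  have base: "P u \<bullet> P v = u \<bullet> v" if "i \<in> I" "u \<in> X i" "j \<in> I" "v \<in> X j" for i j u v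
  proof (cases "i = j")
    case True
    then show ?thesis
      using isometry_on_inner[OF T(1) X T(3)] that PT by metis
  next
    case False
    then have "T i u \<bullet> T j v = 0" using orthY[of i j] T(2) that by blast
    then show ?thesis using PT orthX[of i j u v] that False by simp
  qed
  have step: "P u \<bullet> P v = u \<bullet> v" if "i \<in> I" "u \<in> X i" for i u v
  proof (rule span_induct[of v "\<Union>i\<in>I. X i" "\<lambda>v. P u \<bullet> P v = u \<bullet> v"])
    show "subspace {v. P u \<bullet> P v = u \<bullet> v}"
      by (auto simp: subspace_def linear_0[OF lin] linear_add[OF lin] linear_scale[OF lin] inner_add_right)
  qed (use that span base in auto)
  have "P u \<bullet> P v = u \<bullet> v" for u v
  proof (rule span_induct[of u "\<Union>i\<in>I. X i" "\<lambda>u. P u \<bullet> P v = u \<bullet> v"])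
    show "subspace {u. P u \<bullet> P v = u \<bullet> v}"
      by (auto simp: subspace_def linear_0[OF lin] linear_add[OF lin] linear_scale[OF lin] inner_add_left)
  qed (use span step in auto)
  then show thesis
    using that lin PT by (auto simp: orthogonal_transformation_def)
qed

text \<open>Turns equal multisets of dimensions into a matching of the pieces. Each induction step
  removes one element together with a partner of the same value.\<close>

lemma image_mset_eq_imp_bij_betw:
  assumes "finite A" "finite B" "image_mset f (mset_set A) = image_mset g (mset_set B)"
  shows "\<exists>h. bij_betw h A B \<and> (\<forall>a\<in>A. g (h a) = f a)"
  using assms
proof (induction A arbitrary: B rule: finite_induct)
  case empty
  then show ?case by (auto simp: mset_set_empty_iff bij_betw_def)
next
  case (insert x F)
  then have "f x \<in># image_mset g (mset_set B)"
    by (metis finite.insertI finite_set_mset_mset_set image_eqI insertI1 set_image_mset)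
  then obtain y where y: "y \<in> B" "g y = f x"
    using insert.prems by auto
  have "add_mset (f x) (image_mset f (mset_set F)) = add_mset (g y) (image_mset g (mset_set (B - {y})))"
    using insert y mset_set.remove[OF insert.prems(1) y(1)] by simp
  then have "image_mset f (mset_set F) = image_mset g (mset_set (B - {y}))"
    using y by simp
  then obtain h where h: "bij_betw h F (B - {y})" "\<forall>a\<in>F. g (h a) = f a"
    using insert.IH[of "B - {y}"] insert.prems by blast
  have "bij_betw (h(x := y)) (insert x F) B"
    using h(1) y insert.hyps by (auto simp: bij_betw_def inj_on_def image_iff)
  moreover have "\<forall>a\<in>insert x F. g ((h(x := y)) a) = f a"
    using h y by auto
  ultimately show ?case by blast
qed

text \<open>\<open>T\<close> matches the complex structures of the two pieces. As
  \<open>f' = c' + ?s' J'\<close> and \<open>J = (f - c) / ?s\<close>, it turns \<open>f'\<close>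
  into an affine combination of \<open>f\<close> and \<open>1\<close>. The coefficient
  \<open>\<alpha> = ?s' / ?s\<close> is nonzero, so the relation can later be inverted.\<close>

lemma rot_space_isometry:
  fixes f f' :: "'a::euclidean_space \<Rightarrow> 'a"
  assumes f: "orthogonal_transformation f" and f': "orthogonal_transformation f'"
    and c: "\<bar>c\<bar> < 1" and c': "\<bar>c'\<bar> < 1"
    and dims: "dim (rot_space f c) = dim (rot_space f' c')"
  shows "\<exists>T \<alpha> \<beta>. \<alpha> \<noteq> 0 \<and> linear T \<and> T ` rot_space f c = rot_space f' c' \<and>
    (\<forall>v\<in>rot_space f c. norm (T v) = norm v) \<and>
    (\<forall>v\<in>rot_space f c. f' (T v) = T (\<alpha> *\<^sub>R f v + \<beta> *\<^sub>R v))"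
proof -
  \<comment> \<open>For \<open>\<bar>c\<bar> < 1\<close> the sine
    \<open>sqrt (1 - c\<^sup>2)\<close> is positive, and dividing by it makes \<open>J\<close> an
    isometry with square \<open>-1\<close> on the piece.\<close>
  define J where "J f c v = (1 / sqrt (1 - c\<^sup>2)) *\<^sub>R (f v - c *\<^sub>R v)" for f c and v :: 'a
  have J: "linear (J f c) \<and> J f c ` rot_space f c \<subseteq> rot_space f c \<and>
     (\<forall>v\<in>rot_space f c. J f c (J f c v) = - v) \<and> (\<forall>v\<in>rot_space f c. norm (J f c v) = norm v) \<and>
     (\<forall>v. f v = c *\<^sub>R v + sqrt (1 - c\<^sup>2) *\<^sub>R J f c v) \<and> sqrt (1 - c\<^sup>2) > 0"
    if f: "orthogonal_transformation f" and c: "\<bar>c\<bar> < 1" for f :: "'a \<Rightarrow> 'a" and c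
  proof -
    have lin: "linear f" using f by (rule orthogonal_transformation_linear)
    have "c\<^sup>2 < 1" using c by (simp add: abs_square_less_1)
    then have s: "sqrt (1 - c\<^sup>2) > 0" "(sqrt (1 - c\<^sup>2))\<^sup>2 = 1 - c\<^sup>2" by auto
    have linJ: "linear (J f c)"
      by (rule linearI) (auto simp: J_def linear_add[OF lin] linear_scale[OF lin] algebra_simps)
    have mem: "J f c v \<in> rot_space f c" if "v \<in> rot_space f c" for v
      unfolding J_def using that lin
      by (intro subspace_scale subspace_diff subspace_rot_space rot_space_closed)
    have JJ: "J f c (J f c v) = - v" if v: "v \<in> rot_space f c" for v
    proof -
      have "f (f v) = (2 * c) *\<^sub>R f v - v"
        using v by (simp add: rot_space_def algebra_simps)
      then have "f (f v - c *\<^sub>R v) - c *\<^sub>R (f v - c *\<^sub>R v) = - ((1 - c\<^sup>2) *\<^sub>R v)"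
        by (simp add: linear_diff[OF lin] linear_scale[OF lin] algebra_simps power2_eq_square
            flip: scaleR_add_left)
      moreover have "J f c (J f c v) = (1 / (sqrt (1 - c\<^sup>2))\<^sup>2) *\<^sub>R (f (f v - c *\<^sub>R v) - c *\<^sub>R (f v - c *\<^sub>R v))"
      proof -
        define w k where "w = f v - c *\<^sub>R v" and "k = 1 / sqrt (1 - c\<^sup>2)"
        have "J f c (J f c v) = k *\<^sub>R (k *\<^sub>R f w - c *\<^sub>R k *\<^sub>R w)"
          unfolding J_def by (simp only: w_def[symmetric] k_def[symmetric] linear_scale[OF lin])
        also have "\<dots> = (k * k) *\<^sub>R (f w - c *\<^sub>R w)"
          by (simp add: scaleR_diff_right mult_ac)
        finally show ?thesis
          by (simp add: w_def k_def power2_eq_square)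
      qed
      ultimately show ?thesis
        using s by simp
    qed
    have nrm: "norm (J f c v) = norm v" if v: "v \<in> rot_space f c" for v
    proof -
      have "(f v - c *\<^sub>R v) \<bullet> (f v - c *\<^sub>R v) = f v \<bullet> f v - 2 * c * (f v \<bullet> v) + c * c * (v \<bullet> v)"
        by (simp add: inner_diff_left inner_diff_right inner_commute algebra_simps)
      also have "\<dots> = (1 - c\<^sup>2) * (v \<bullet> v)"
        using f by (simp add: rot_space_inner[OF f v] orthogonal_transformation_def algebra_simps
            power2_eq_square)
      finally have "(norm (f v - c *\<^sub>R v))\<^sup>2 = (sqrt (1 - c\<^sup>2) * norm v)\<^sup>2"
        by (simp only: power2_norm_eq_inner power_mult_distrib s(2))
      then have "norm (f v - c *\<^sub>R v) = sqrt (1 - c\<^sup>2) * norm v"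
        by (rule power2_eq_imp_eq) (use s in auto)
      then show ?thesis using s by (simp add: J_def)
    qed
    have "f v = c *\<^sub>R v + sqrt (1 - c\<^sup>2) *\<^sub>R J f c v" for v
      using s by (simp add: J_def)
    then show ?thesis using s linJ mem JJ nrm by blast
  qed
  let ?s = "sqrt (1 - c\<^sup>2)" and ?s' = "sqrt (1 - c'\<^sup>2)"
  have lin: "linear f" "linear f'"
    using f f' by (auto simp: orthogonal_transformation_linear)
  note J1 = J[OF f c] and J2 = J[OF f' c']
  have "\<exists>T. linear T \<and> T ` rot_space f c \<subseteq> rot_space f' c' \<and> (\<forall>v\<in>rot_space f c. norm (T v) = norm v) \<and>
      (\<forall>v\<in>rot_space f c. T (J f c v) = J f' c' (T v))"
    using J1 J2 dims lin by (intro complex_structure_isometry subspace_rot_space) blast+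
  then obtain T where T: "linear T" "T ` rot_space f c \<subseteq> rot_space f' c'"
    "\<And>v. v \<in> rot_space f c \<Longrightarrow> norm (T v) = norm v"
    "\<And>v. v \<in> rot_space f c \<Longrightarrow> T (J f c v) = J f' c' (T v)" by blast
  have "T ` rot_space f c = rot_space f' c'"
    by (rule isometry_on_image[OF T(1) subspace_rot_space subspace_rot_space T(2) dims T(3)])
      (use lin in auto)
  moreover have "f' (T v) = T ((?s' / ?s) *\<^sub>R f v + (c' - ?s' / ?s * c) *\<^sub>R v)" if v: "v \<in> rot_space f c" for v
  proof -
    have s0: "?s \<noteq> 0" using J1 by auto
    have "f' (T v) = c' *\<^sub>R T v + ?s' *\<^sub>R T (J f c v)"
      using J2 T(4)[OF v] by metis
    also have "\<dots> = T (c' *\<^sub>R v + ?s' *\<^sub>R J f c v)"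
      by (simp add: linear_add[OF T(1)] linear_scale[OF T(1)])
    also have "c' *\<^sub>R v + ?s' *\<^sub>R J f c v = (?s' / ?s) *\<^sub>R f v + (c' - ?s' / ?s * c) *\<^sub>R v"
      using s0 by (simp add: J_def algebra_simps)
    finally show ?thesis .
  qed
  moreover have "?s' / ?s \<noteq> 0" using J1 J2 by auto
  ultimately show ?thesis using T by blast
qed

text \<open>Every linear isometry between the pieces intertwines, as both maps act there as the
  scalar \<open>e\<close>. It is corrected by the reflection exchanging \<open>T a\<close> and
  \<open>a'\<close>, which have equal norms.\<close>

lemma rot_space_isometry_unit:
  fixes f f' :: "'a::euclidean_space \<Rightarrow> 'a"
  assumes f: "orthogonal_transformation f" and f': "orthogonal_transformation f'"
    and e: "\<bar>e\<bar> = 1" and dims: "dim (rot_space f e) = dim (rot_space f' e)"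
    and a: "a \<in> rot_space f e" and a': "a' \<in> rot_space f' e" and nrm: "norm a = norm a'"
  shows "\<exists>T. linear T \<and> T ` rot_space f e = rot_space f' e \<and>
    (\<forall>v\<in>rot_space f e. norm (T v) = norm v) \<and> T a = a' \<and>
    (\<forall>v\<in>rot_space f e. f' (T v) = T (f v))"
proof -
  have lin: "linear f" "linear f'"
    using f f' by (auto simp: orthogonal_transformation_linear)
  obtain T where T: "linear T" "T ` rot_space f e = rot_space f' e"
    "\<And>v. v \<in> rot_space f e \<Longrightarrow> norm (T v) = norm v"
    using isometry_subspaces[OF subspace_rot_space subspace_rot_space dims] lin by metis
  define x where "x = T a"
  have x: "x \<in> rot_space f' e" "norm x = norm a'"
    using T a nrm by (auto simp: x_def)
  have fx: "f' (x - a') = e *\<^sub>R (x - a')"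
    using x a' rot_space_unit[OF f' e] subspace_diff[OF subspace_rot_space[OF lin(2)]] by blast
  \<comment> \<open>The reflection in the hyperplane orthogonal to \<open>x - a'\<close>; it is the
    identity if \<open>x = a'\<close>.\<close>
  obtain R where R: "orthogonal_transformation R" "\<And>v. R v = - v \<longleftrightarrow> v \<in> span {x - a'}"
    and fixR: "\<And>v. R v = v \<longleftrightarrow> (\<forall>u\<in>span {x - a'}. u \<bullet> v = 0)"
    and commR: "\<And>f' x'. orthogonal_transformation f' \<Longrightarrow> f' ` span {x - a'} = span {x - a'} \<Longrightarrow> R (f' x') = f' (R x')"
    by (rule reflection_exists[OF subspace_span[of "{x - a'}"]]) (rule that)
  have linR: "linear R" using R(1) by (rule orthogonal_transformation_linear)
  have ee: "e * e = 1"
    using e by (metis abs_mult_self_eq mult_1)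
  have "f' ` span {x - a'} = span (f' ` {x - a'})"
    using linear_span_image[OF lin(2), of "{x - a'}"] by simp
  also have "\<dots> = span {x - a'}"
  proof -
    have "e *\<^sub>R e *\<^sub>R (x - a') \<in> span {e *\<^sub>R (x - a')}"
      by (intro span_scale span_base) simp
    then have "x - a' \<in> span {e *\<^sub>R (x - a')}"
      by (simp only: scaleR_scaleR ee scaleR_one)
    moreover have "e *\<^sub>R (x - a') \<in> span {x - a'}"
      by (intro span_scale span_base) simp
    ultimately show ?thesis
      unfolding image_insert image_empty fx
      by (intro subset_antisym span_minimal subspace_span) auto
  qed
  finally have comm: "R (f' v) = f' (R v)" for v
    using commR[OF f'] by blast
  have "R (x - a') = - (x - a')"
    using R(2)[of "x - a'"] by (simp add: span_base)
  moreover have "R (x + a') = x + a'"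
  proof -
    have "(x - a') \<bullet> (x + a') = 0"
      using x(2) by (simp add: inner_diff_left inner_diff_right inner_add_left inner_add_right
          inner_commute norm_eq)
    then show ?thesis
      unfolding fixR by (auto simp: span_singleton)
  qed
  \<comment> \<open>\<open>2 x\<close> is the sum of \<open>x - a'\<close>, which \<open>R\<close>
    negates, and \<open>x + a'\<close>, which \<open>R\<close> fixes because the norms agree; so
    \<open>R x = a'\<close>.\<close>
  ultimately have "R ((x - a') + (x + a')) = - (x - a') + (x + a')"
    by (simp only: linear_add[OF linR])
  then have "2 *\<^sub>R R x = 2 *\<^sub>R a'"
    by (simp add: linear_add[OF linR] scaleR_2)
  then have Rx: "R x = a'" by simp
  have RW: "R v \<in> rot_space f' e" if "v \<in> rot_space f' e" for v
    using rot_space_commute_mem[OF linR comm that] .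
  have linRT: "linear (R \<circ> T)" using linear_compose[OF T(1) linR] .
  have sub: "(R \<circ> T) ` rot_space f e \<subseteq> rot_space f' e"
    using T(2) RW by auto
  have nRT: "norm ((R \<circ> T) v) = norm v" if "v \<in> rot_space f e" for v
    using that T(3) R(1) by (simp add: orthogonal_transformation)
  have "(R \<circ> T) ` rot_space f e = rot_space f' e"
    by (rule isometry_on_image[OF linRT subspace_rot_space subspace_rot_space sub dims nRT])
      (use lin in auto)
  moreover have "f' ((R \<circ> T) v) = (R \<circ> T) (f v)" if "v \<in> rot_space f e" for v
  proof -
    have "(R \<circ> T) v \<in> rot_space f' e" using sub that by blast
    then show ?thesis
      using that rot_space_unit[OF f e, of v] rot_space_unit[OF f' e, of "(R \<circ> T) v"]
      by (simp add: linear_scale[OF T(1)] linear_scale[OF linR])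
  qed
  ultimately show ?thesis
    using linRT nRT Rx by (intro exI[of _ "R \<circ> T"]) (auto simp: x_def)
qed

text \<open>The scalars may depend on the piece \<open>c\<close>: for complex pieces of different angles, \<open>P\<close> matches
  the complex structures but not \<open>f\<close> with \<open>f'\<close>.\<close>
definition intertwines :: "('a::real_vector \<Rightarrow> 'a) \<Rightarrow> ('a \<Rightarrow> 'a) \<Rightarrow> ('a \<Rightarrow> 'a) \<Rightarrow> bool" where
  "intertwines f f' P \<longleftrightarrow>
     (\<forall>c. \<exists>\<alpha> \<beta>. \<forall>v\<in>rot_space f c. f' (P v) = P (\<alpha> *\<^sub>R f v + \<beta> *\<^sub>R v))"

text \<open>On one piece, \<open>f'\<close> pulled back along \<open>P\<close> is
  \<open>\<alpha> f + \<beta>\<close>. A map \<open>B\<close> commuting with \<open>f\<close>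
  preserves the piece, so the same scalars serve for \<open>v\<close> and \<open>B v\<close>; the
  pieces span the space.\<close>

lemma intertwines_commute:
  fixes f f' :: "'a::euclidean_space \<Rightarrow> 'a"
  assumes f: "orthogonal_transformation f" and f': "orthogonal_transformation f'"
    and P: "orthogonal_transformation P" and "intertwines f f' P"
    and B: "linear B" "\<And>x. B (f x) = f (B x)"
  shows "P (B (inv P (f' x))) = f' (P (B (inv P x)))"
proof -
  have linP: "linear P" and bijP: "bij P"
    using P orthogonal_transformation_linear orthogonal_transformation_bij by auto
  have invP: "inv P (P y) = y" "P (inv P y) = y" for y
    using bijP by (auto simp: bij_is_inj bij_is_surj surj_f_inv_f)
  have linI: "linear (inv P)"
    using P orthogonal_transformation_inv orthogonal_transformation_linear by blast
  have linf': "linear f'" using f' by (rule orthogonal_transformation_linear)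
  have *: "P (B (inv P (f' (P v)))) = f' (P (B v))" for v
  proof (rule span_induct[of v "\<Union>c. rot_space f c" "\<lambda>v. P (B (inv P (f' (P v)))) = f' (P (B v))"])
    show "subspace {v. P (B (inv P (f' (P v)))) = f' (P (B v))}"
      by (auto simp: subspace_def linear_0 linear_add linear_scale linP linI linf' B(1))
    fix v assume "v \<in> (\<Union>c. rot_space f c)"
    then obtain c where v: "v \<in> rot_space f c" by blast
    obtain \<alpha> \<beta> where ab: "\<And>v. v \<in> rot_space f c \<Longrightarrow> f' (P v) = P (\<alpha> *\<^sub>R f v + \<beta> *\<^sub>R v)"
      using \<open>intertwines f f' P\<close> unfolding intertwines_def by blast
    show "P (B (inv P (f' (P v)))) = f' (P (B v))"
      using ab[OF v] ab[OF rot_space_commute_mem[OF B v]]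
      by (simp add: invP linear_add[OF B(1)] linear_scale[OF B(1)] B(2))
  qed (simp add: span_rot_spaces[OF f])
  show ?thesis using *[of "inv P x"] by (simp add: invP)
qed

text \<open>The pieces for \<open>1\<close> and \<open>-1\<close> are matched with their
  counterparts, the others through the equality of dimensions, and the isometries between them are
  glued. All \<open>\<alpha>\<close> are nonzero, hence \<open>inv P\<close> intertwines as
  well.\<close>

lemma exists_intertwiner:
  fixes f f' :: "'a::euclidean_space \<Rightarrow> 'a"
  assumes f: "orthogonal_transformation f" and f': "orthogonal_transformation f'"
    and a: "f a = a" and a': "f' a' = a'" and nrm: "norm a = norm a'"
    and d1: "dim (rot_space f 1) = dim (rot_space f' 1)"
    and dm1: "dim (rot_space f (-1)) = dim (rot_space f' (-1))"
    and dims: "rot_dims f = rot_dims f'"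
  obtains P where "orthogonal_transformation P" "P a = a'" "P ` rot_space f 1 = rot_space f' 1"
    "intertwines f f' P" "intertwines f' f (inv P)"
proof -
  have lin: "linear f" "linear f'"
    using f f' by (auto simp: orthogonal_transformation_linear)
  define C where "C f = {c. \<bar>c\<bar> < 1 \<and> rot_space f c \<noteq> {0}}" for f :: "'a \<Rightarrow> 'a"
  have finC: "finite (C f)" if "orthogonal_transformation f" for f :: "'a \<Rightarrow> 'a"
    unfolding C_def by (rule finite_subset[OF _ finite_rot_spaces[OF that]]) auto
  obtain h where h: "bij_betw h (C f) (C f')" "\<And>c. c \<in> C f \<Longrightarrow> dim (rot_space f' (h c)) = dim (rot_space f c)"
    using image_mset_eq_imp_bij_betw[OF finC[OF f] finC[OF f'] dims[unfolded rot_dims_def, folded C_def]]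
    by blast
  \<comment> \<open>\<open>1\<close> and \<open>-1\<close> are indices even when their pieces are
    zero; this makes \<open>T 1\<close> available to send \<open>a\<close> to \<open>a'\<close> in
    all cases.\<close>
  define I where "I = {1, -1} \<union> C f"
  define \<sigma> where "\<sigma> c = (if c \<in> C f then h c else c)" for c
  have hC: "\<bar>h c\<bar> < 1" if "c \<in> C f" for c
    using h(1) that by (auto simp: bij_betw_def C_def)
  have \<sigma>1: "\<sigma> 1 = 1" "\<sigma> (-1) = -1" by (auto simp: \<sigma>_def C_def)
  have inj: "inj_on \<sigma> I"
  proof (rule inj_onI)
    fix x y assume xy: "x \<in> I" "y \<in> I" "\<sigma> x = \<sigma> y"
    have *: "\<bar>\<sigma> c\<bar> < 1 \<longleftrightarrow> c \<in> C f" if "c \<in> I" for c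
      using that hC[of c] by (auto simp: I_def \<sigma>_def)
    have "x \<in> C f \<longleftrightarrow> y \<in> C f" using *[OF xy(1)] *[OF xy(2)] xy(3) by simp
    then show "x = y"
      using xy(3) h(1) by (cases "x \<in> C f") (auto simp: \<sigma>_def bij_betw_def dest: inj_onD)
  qed
  have surj: "\<exists>c\<in>I. d = \<sigma> c" if d: "rot_space f' d \<noteq> {0}" for d
  proof -
    obtain v where "v \<in> rot_space f' d" "v \<noteq> 0"
      using d rot_space_nontrivial[OF lin(2)] by blast
    then have "\<bar>d\<bar> \<le> 1" by (rule rot_space_bound[OF f'])
    then consider "d = 1" | "d = -1" | "d \<in> C f'"
      using d by (force simp: C_def)
    then show ?thesis
    proof cases
      case 3
      then obtain c where "c \<in> C f" "d = h c" using h(1) by (auto simp: bij_betw_def)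
      then show ?thesis by (auto simp: I_def \<sigma>_def)
    qed (use \<sigma>1 in \<open>auto simp: I_def\<close>)
  qed
  define Q where "Q c T \<alpha> \<beta> \<longleftrightarrow> \<alpha> \<noteq> 0 \<and> linear T \<and> T ` rot_space f c = rot_space f' (\<sigma> c) \<and>
    (\<forall>v\<in>rot_space f c. norm (T v) = norm v) \<and>
    (\<forall>v\<in>rot_space f c. f' (T v) = T (\<alpha> *\<^sub>R f v + \<beta> *\<^sub>R v)) \<and> (c = 1 \<longrightarrow> T a = a')"
    for c T and \<alpha> \<beta> :: real
  have "\<exists>T \<alpha> \<beta>. Q c T \<alpha> \<beta>"
    if "c \<in> I" for c
  proof -
    have unit: ?thesis if u: "\<sigma> c = c" "\<bar>c\<bar> = 1" "dim (rot_space f c) = dim (rot_space f' c)"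
      "x \<in> rot_space f c" "x' \<in> rot_space f' c" "norm x = norm x'" "c = 1 \<Longrightarrow> x = a \<and> x' = a'" for x x'
    proof -
      obtain T where "linear T" "T ` rot_space f c = rot_space f' c"
        "\<forall>v\<in>rot_space f c. norm (T v) = norm v" "T x = x'" "\<forall>v\<in>rot_space f c. f' (T v) = T (f v)"
        using rot_space_isometry_unit[OF f f' u(2-6)] by blast
      then show ?thesis
        using u by (intro exI[of _ T] exI[of _ 1] exI[of _ 0]) (auto simp: Q_def)
    qed
    consider "c = 1" | "c = -1" | "c \<in> C f" using \<open>c \<in> I\<close> by (auto simp: I_def)
    then show ?thesis
    proof cases
      case 1
      then show ?thesis
        using unit[of a a'] \<sigma>1 d1 a a' nrm by (simp add: rot_space_one f f')
    next
      \<comment> \<open>No vector is prescribed in the piece for \<open>-1\<close>, so the zero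
        vectors are matched.\<close>
      case 2
      then show ?thesis
        using unit[of 0 0] \<sigma>1 dm1 zero_in_rot_space[OF lin(1)] zero_in_rot_space[OF lin(2)] by simp
    next
      case 3
      then have "\<bar>c\<bar> < 1" "\<bar>\<sigma> c\<bar> < 1" "dim (rot_space f c) = dim (rot_space f' (\<sigma> c))" "c \<noteq> 1"
        using hC h(2) by (auto simp: C_def \<sigma>_def)
      note case3 = this
      obtain T \<alpha> \<beta> where "Q c T \<alpha> \<beta>"
        using rot_space_isometry[OF f f' case3(1-3)] case3(4) unfolding Q_def by blast
      then show ?thesis by blast
    qed
  qed
  then obtain T \<alpha> \<beta> where Q: "\<And>c. c \<in> I \<Longrightarrow> Q c (T c) (\<alpha> c) (\<beta> c)"
    by metis
  have T: "\<And>c. c \<in> I \<Longrightarrow> \<alpha> c \<noteq> 0" "\<And>c. c \<in> I \<Longrightarrow> linear (T c)"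
     "\<And>c. c \<in> I \<Longrightarrow> T c ` rot_space f c = rot_space f' (\<sigma> c)"
     "\<And>c v. \<lbrakk>c \<in> I; v \<in> rot_space f c\<rbrakk> \<Longrightarrow> norm (T c v) = norm v"
     "\<And>c v. \<lbrakk>c \<in> I; v \<in> rot_space f c\<rbrakk> \<Longrightarrow> f' (T c v) = T c (\<alpha> c *\<^sub>R f v + \<beta> c *\<^sub>R v)"
     "1 \<in> I \<Longrightarrow> T 1 a = a'"
    using Q by (simp_all add: Q_def)
  have out: "rot_space f c = {0}" if "c \<notin> I" for c
  proof (rule ccontr)
    assume nt: "rot_space f c \<noteq> {0}"
    then obtain v where "v \<in> rot_space f c" "v \<noteq> 0"
      using rot_space_nontrivial[OF lin(1)] by blast
    then have "\<bar>c\<bar> \<le> 1" by (rule rot_space_bound[OF f])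
    then show False
      using that nt by (force simp: I_def C_def)
  qed
  have spanI: "span (\<Union>c\<in>I. rot_space f c) = UNIV"
  proof -
    have "(\<Union>c. rot_space f c) \<subseteq> span (\<Union>c\<in>I. rot_space f c)"
    proof
      fix v assume "v \<in> (\<Union>c. rot_space f c)"
      then obtain c where v: "v \<in> rot_space f c" by blast
      show "v \<in> span (\<Union>c\<in>I. rot_space f c)"
      proof (cases "c \<in> I")
        case True then show ?thesis using v by (blast intro: span_base)
      next
        case False then show ?thesis using v out span_0 by auto
      qed
    qed
    then show ?thesis
      using span_minimal[OF _ subspace_span] span_rot_spaces[OF f] by blast
  qed
  obtain P where P: "orthogonal_transformation P" "\<And>c v. \<lbrakk>c \<in> I; v \<in> rot_space f c\<rbrakk> \<Longrightarrow> P v = T c v"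
  proof (rule glue_isometries[of I "rot_space f" "\<lambda>c. rot_space f' (\<sigma> c)" T])
    show "finite I" using finC[OF f] by (simp add: I_def)
    show "x \<bullet> y = 0" if "i \<in> I" "j \<in> I" "i \<noteq> j" "x \<in> rot_space f' (\<sigma> i)" "y \<in> rot_space f' (\<sigma> j)" for i j x y
      using rot_space_orthogonal[OF f' that(4,5)] inj that(1-3) by (auto simp: inj_on_def)
  qed (use T spanI lin rot_space_orthogonal[OF f] in \<open>auto intro: subspace_rot_space\<close>)
  have lc: "\<alpha> *\<^sub>R f v + \<beta> *\<^sub>R v \<in> rot_space f c" if "v \<in> rot_space f c" for \<alpha> \<beta> c v
    using that lin by (intro subspace_add subspace_scale subspace_rot_space rot_space_closed)
  have tw: "f' (P v) = P (\<alpha> c *\<^sub>R f v + \<beta> c *\<^sub>R v)" if "c \<in> I" "v \<in> rot_space f c" for c v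
    using T(5)[OF that] P(2)[OF that] P(2)[OF that(1) lc[OF that(2)]] by simp
  have im: "P ` rot_space f c = rot_space f' (\<sigma> c)" if "c \<in> I" for c
    using T(3)[OF that] P(2)[OF that] by (simp cong: image_cong)
  have linP: "linear P" and bijP: "bij P"
    using P orthogonal_transformation_linear orthogonal_transformation_bij by auto
  have invP: "inv P (P y) = y" "P (inv P y) = y" for y
    using bijP by (auto simp: bij_is_inj bij_is_surj surj_f_inv_f)
  have linI: "linear (inv P)"
    using P orthogonal_transformation_inv orthogonal_transformation_linear by blast
  have "1 \<in> I" by (simp add: I_def)
  have "P a = a'"
    using P(2)[OF \<open>1 \<in> I\<close>, of a] a T(6)[OF \<open>1 \<in> I\<close>] by (simp add: rot_space_one[OF f])
  moreover have "P ` rot_space f 1 = rot_space f' 1"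
    using im[OF \<open>1 \<in> I\<close>] \<sigma>1 by simp
  moreover have "intertwines f f' P"
    unfolding intertwines_def
  proof
    fix c show "\<exists>\<alpha> \<beta>. \<forall>v\<in>rot_space f c. f' (P v) = P (\<alpha> *\<^sub>R f v + \<beta> *\<^sub>R v)"
    proof (cases "c \<in> I")
      case True then show ?thesis using tw by blast
    next
      case False
      then show ?thesis
        using out lin linP by (simp add: linear_0)
    qed
  qed
  moreover have "intertwines f' f (inv P)"
    unfolding intertwines_def
  proof
    fix d show "\<exists>\<alpha> \<beta>. \<forall>v\<in>rot_space f' d. f (inv P v) = inv P (\<alpha> *\<^sub>R f' v + \<beta> *\<^sub>R v)"
    proof (cases "rot_space f' d = {0}")
      case True
      have "f (inv P 0) = inv P (0 *\<^sub>R f' 0 + 0 *\<^sub>R 0)"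
        by (simp add: linear_0[OF linI] linear_0[OF lin(1)])
      then show ?thesis unfolding True by blast
    next
      case False
      obtain c where c: "c \<in> I" "d = \<sigma> c" using surj[OF False] by (rule bexE)
      \<comment> \<open>The relation \<open>f' (P w) = P (\<alpha> f w + \<beta> w)\<close> is
        solved for \<open>f w\<close>, dividing by \<open>\<alpha>\<close>.\<close>
      have "f (inv P v) = inv P ((1 / \<alpha> c) *\<^sub>R f' v + (- \<beta> c / \<alpha> c) *\<^sub>R v)" if "v \<in> rot_space f' d" for v
      proof -
        have "v \<in> P ` rot_space f c"
          using that unfolding c(2) im[OF c(1)] .
        then obtain w where w: "w \<in> rot_space f c" "v = P w" by blast
        have "inv P (f' v) = \<alpha> c *\<^sub>R f w + \<beta> c *\<^sub>R w"
          unfolding w(2) tw[OF c(1) w(1)] invP(1) ..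
        then have "(1 / \<alpha> c) *\<^sub>R inv P (f' v) + (- \<beta> c / \<alpha> c) *\<^sub>R w = f w"
          using T(1)[OF c(1)] by (simp add: scaleR_add_right)
        moreover have "inv P v = w" unfolding w(2) by (rule invP)
        ultimately show ?thesis
          by (simp only: linear_add[OF linI] linear_scale[OF linI])
      qed
      then show ?thesis by blast
    qed
  qed
  ultimately show thesis using that P(1) by blast
qed

section \<open>The Segre symbol in terms of the isotypic pieces\<close>

lemma scaleR_eq_vec_scale: "r *\<^sub>R (x :: complex^'n) = complex_of_real r *s x"
  by (simp add: vec_eq_iff complex_eq_iff)

lemma vec_subspace_imp_subspace:
  fixes E :: "(complex^'n) set"
  assumes "vec.subspace E"
  shows "subspace E"
  using assms by (auto simp: subspace_def vec.subspace_def scaleR_eq_vec_scale)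

text \<open>Over the reals each new complex basis vector \<open>b\<close> contributes both
  \<open>b\<close> and \<open>\<i> *s b\<close>. Neither is redundant, since no nonzero complex
  multiple of \<open>b\<close> lies in the complex span of \<open>B\<close>.\<close>

lemma dim_vec_span_independent:
  fixes B :: "(complex^'n) set"
  assumes "finite B" "vec.independent B"
  shows "dim (vec.span B) = 2 * card B"
  using assms
proof (induction B rule: finite_induct)
  case (insert b B)
  have b: "b \<notin> vec.span B" and B: "vec.independent B"
    using insert.prems insert.hyps by (auto simp: vec.independent_insert)
  have sub: "subspace (vec.span S)" for S :: "(complex^'n) set"
    by (rule vec_subspace_imp_subspace) (rule vec.subspace_span)
  have spanB: "span (vec.span B) = vec.span B"
    using sub by (rule span_eq_iff[THEN iffD2])
  have key: "k = 0" if "k *s b \<in> vec.span B" for k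
  proof (rule ccontr)
    assume "k \<noteq> 0"
    then have "b = inverse k *s (k *s b)" by simp
    then show False using b vec.span_scale[OF that] by metis
  qed
  have ib: "\<i> *s b \<notin> span (vec.span B)"
    unfolding spanB using key[of \<i>] by auto
  have bb: "b \<notin> span (insert (\<i> *s b) (vec.span B))"
  proof
    assume "b \<in> span (insert (\<i> *s b) (vec.span B))"
    then obtain k where "b - k *\<^sub>R (\<i> *s b) \<in> vec.span B"
      unfolding span_breakdown_eq spanB by blast
    \<comment> \<open>A scalar with real part \<open>1\<close> is nonzero, which contradicts
      \<open>key\<close>.\<close>
    moreover have "b - k *\<^sub>R (\<i> *s b) = Complex 1 (- k) *s b"
      by (simp add: vec_eq_iff complex_eq_iff)
    ultimately show False using key by (fastforce simp: complex_eq_iff)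
  qed
  have "vec.span (insert b B) = span (insert b (insert (\<i> *s b) (vec.span B)))"
  proof
    show "span (insert b (insert (\<i> *s b) (vec.span B))) \<subseteq> vec.span (insert b B)"
    proof (rule span_minimal[OF _ sub])
      have "vec.span B \<subseteq> vec.span (insert b B)"
        by (rule vec.span_mono) auto
      then show "insert b (insert (\<i> *s b) (vec.span B)) \<subseteq> vec.span (insert b B)"
        by (auto intro: vec.span_base vec.span_scale)
    qed
    show "vec.span (insert b B) \<subseteq> span (insert b (insert (\<i> *s b) (vec.span B)))"
    proof
      fix x assume "x \<in> vec.span (insert b B)"
      then obtain k where k: "x - k *s b \<in> vec.span B"
        unfolding vec.span_breakdown_eq by blast
      have "x = Re k *\<^sub>R b + Im k *\<^sub>R (\<i> *s b) + (x - k *s b)"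
        by (simp add: vec_eq_iff complex_eq_iff)
      moreover have "Re k *\<^sub>R b + Im k *\<^sub>R (\<i> *s b) + (x - k *s b)
          \<in> span (insert b (insert (\<i> *s b) (vec.span B)))"
        using k by (intro span_add span_scale) (auto intro: span_base)
      ultimately show "x \<in> span (insert b (insert (\<i> *s b) (vec.span B)))" by metis
    qed
  qed
  then have "dim (vec.span (insert b B)) = dim (insert b (insert (\<i> *s b) (vec.span B)))"
    by simp
  also have "\<dots> = dim (vec.span B) + 2"
    using ib bb by (simp add: dim_insert)
  finally show ?case
    using insert.IH[OF B] insert.hyps by simp
qed simp

lemma dim_eq_twice_vec_dim:
  fixes E :: "(complex^'n) set"
  assumes "vec.subspace E"
  shows "dim E = 2 * vec.dim E"
proof -
  obtain B where B: "B \<subseteq> E" "vec.independent B" "E \<subseteq> vec.span B" "card B = vec.dim E"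
    using vec.basis_exists by blast
  have "vec.span B = E"
    using B assms by (intro subset_antisym vec.span_minimal)
  then show ?thesis
    using dim_vec_span_independent[OF vec.finiteI_independent[OF B(2)] B(2)] B(4) by simp
qed

section \<open>Real and imaginary parts of complex eigenvectors\<close>

definition re_vec :: "complex^'n \<Rightarrow> real^'n" where "re_vec z = (\<chi> i. Re (z $ i))"
definition im_vec :: "complex^'n \<Rightarrow> real^'n" where "im_vec z = (\<chi> i. Im (z $ i))"

lemma linear_re_vec: "linear re_vec"
  by (rule linearI) (simp_all add: re_vec_def vec_eq_iff)

lemma complexify_iff: "z \<in> complexify W \<longleftrightarrow> re_vec z \<in> W \<and> im_vec z \<in> W"
proof
  assume "z \<in> complexify W"
  then obtain x y where "x \<in> W" "y \<in> W" "z = (\<chi> i. Complex (x $ i) (y $ i))"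
    by (auto simp: complexify_def)
  then show "re_vec z \<in> W \<and> im_vec z \<in> W"
    by (simp add: re_vec_def im_vec_def)
next
  assume "re_vec z \<in> W \<and> im_vec z \<in> W"
  moreover have "z = (\<chi> i. Complex (re_vec z $ i) (im_vec z $ i))"
    by (simp add: vec_eq_iff re_vec_def im_vec_def)
  ultimately show "z \<in> complexify W"
    unfolding complexify_def by blast
qed

lemma cmat_eigen_iff:
  "cmat A *v z = l *s z \<longleftrightarrow>
     A *v re_vec z = Re l *\<^sub>R re_vec z - Im l *\<^sub>R im_vec z \<and>
     A *v im_vec z = Im l *\<^sub>R re_vec z + Re l *\<^sub>R im_vec z"
  by (auto simp: vec_eq_iff cmat_def re_vec_def im_vec_def matrix_vector_mult_def complex_eq_iff
      algebra_simps)

lemma ceig_space_iff: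
  "z \<in> ceig_space A W l \<longleftrightarrow> re_vec z \<in> W \<and> im_vec z \<in> W \<and>
     A *v re_vec z = Re l *\<^sub>R re_vec z - Im l *\<^sub>R im_vec z \<and>
     A *v im_vec z = Im l *\<^sub>R re_vec z + Re l *\<^sub>R im_vec z"
  by (simp add: ceig_space_def complexify_iff cmat_eigen_iff)

lemma vec_subspace_ceig_space:
  assumes "subspace W"
  shows "vec.subspace (ceig_space A W l)"
proof -
  have z: "re_vec 0 = 0" "im_vec 0 = 0"
    and add: "re_vec (x + y) = re_vec x + re_vec y" "im_vec (x + y) = im_vec x + im_vec y"
    and scale: "re_vec (k *s x) = Re k *\<^sub>R re_vec x - Im k *\<^sub>R im_vec x"
      "im_vec (k *s x) = Re k *\<^sub>R im_vec x + Im k *\<^sub>R re_vec x" for x y and k :: complex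
    by (simp_all add: vec_eq_iff re_vec_def im_vec_def)
  show ?thesis
    unfolding vec.subspace_def
  proof (intro conjI ballI allI)
    show "0 \<in> ceig_space A W l"
      using assms by (simp add: ceig_space_def complexify_iff z subspace_0)
    show "x + y \<in> ceig_space A W l" if "x \<in> ceig_space A W l" "y \<in> ceig_space A W l" for x y
      using that assms
      by (simp add: ceig_space_def complexify_iff add subspace_add vec.scale_right_distrib
          matrix_vector_right_distrib)
    show "k *s x \<in> ceig_space A W l" if "x \<in> ceig_space A W l" for k x
      using that assms
      by (simp add: ceig_space_def complexify_iff scale subspace_add subspace_diff subspace_scale
          vector_scalar_commute mult.commute)
  qed
qed

lemma orthogonal_transformation_matrix_mult:
  "orthogonal_matrix (A :: real^'n^'n) \<Longrightarrow> orthogonal_transformation ((*v) A)"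
  by (simp add: orthogonal_transformation_matrix)

lemma subspace_R_space: "subspace (R_space A)"
  by (auto simp: R_space_def subspace_def inner_add_right)

lemma rot_space_subset_R_space:
  assumes "orthogonal_matrix A" "c \<noteq> 1"
  shows "rot_space ((*v) A) c \<subseteq> R_space A"
proof -
  have f: "orthogonal_transformation ((*v) A)"
    using assms by (simp add: orthogonal_transformation_matrix_mult)
  show ?thesis
    using rot_space_orthogonal[OF f, of _ 1 _ c] assms(2)
    by (auto simp: R_space_def rot_space_one[OF f])
qed

text \<open>\<open>A\<close> preserves the sum of the squared norms of the real and imaginary parts,
  while multiplication by \<open>l\<close> scales it by the squared modulus of
  \<open>l\<close>.\<close>

lemma ceig_space_unit:
  assumes A: "orthogonal_matrix A" and z: "z \<in> ceig_space A W l" "z \<noteq> 0"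
  shows "(Re l)\<^sup>2 + (Im l)\<^sup>2 = 1"
proof -
  let ?x = "re_vec z" and ?y = "im_vec z"
  have n: "(A *v v) \<bullet> (A *v v) = v \<bullet> v" for v
    using orthogonal_transformation_matrix_mult[OF A] by (auto simp: orthogonal_transformation_def)
  have "?x \<bullet> ?x + ?y \<bullet> ?y = (A *v ?x) \<bullet> (A *v ?x) + (A *v ?y) \<bullet> (A *v ?y)"
    by (simp add: n)
  also have "\<dots> = ((Re l)\<^sup>2 + (Im l)\<^sup>2) * (?x \<bullet> ?x + ?y \<bullet> ?y)"
  proof -
    have x: "A *v ?x = Re l *\<^sub>R ?x - Im l *\<^sub>R ?y" and y: "A *v ?y = Im l *\<^sub>R ?x + Re l *\<^sub>R ?y"
      using z(1) by (auto simp: ceig_space_iff)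
    show ?thesis
      unfolding x y by (simp add: inner_add_left inner_add_right inner_diff_left
          inner_diff_right inner_commute power2_eq_square algebra_simps)
  qed
  finally have "((Re l)\<^sup>2 + (Im l)\<^sup>2 - 1) * (?x \<bullet> ?x + ?y \<bullet> ?y) = 0"
    by (simp only: left_diff_distrib mult_1_left)
  moreover have "?x \<bullet> ?x + ?y \<bullet> ?y \<noteq> 0"
  proof
    assume "?x \<bullet> ?x + ?y \<bullet> ?y = 0"
    then have "?x = 0" "?y = 0"
      by (metis add_nonneg_eq_0_iff inner_eq_zero_iff inner_ge_zero)+
    then show False
      using z(2) by (simp add: vec_eq_iff re_vec_def im_vec_def complex_eq_iff)
  qed
  ultimately show ?thesis by simp
qed

text \<open>Taking real parts is a real-linear bijection from the complex eigenspace onto the piece: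
  the imaginary part is recovered as \<open>(c x - A x) / s\<close>. The factor \<open>2\<close> is
  the ratio of real to complex dimension.\<close>

lemma dim_ceig_space:
  assumes A: "orthogonal_matrix A" and l: "(Re l)\<^sup>2 + (Im l)\<^sup>2 = 1" "Im l > 0"
  shows "dim (rot_space ((*v) A) (Re l)) = 2 * vec.dim (ceig_space A (R_space A) l)"
proof -
  define c s where "c = Re l" and "s = Im l"
  have cs: "c\<^sup>2 + s\<^sup>2 = 1" "s > 0" using l by (auto simp: c_def s_def)
  let ?E = "ceig_space A (R_space A) l" and ?W = "rot_space ((*v) A) c"
  have f: "orthogonal_transformation ((*v) A)"
    using A by (simp add: orthogonal_transformation_matrix_mult)
  \<comment> \<open>Positivity of \<open>s\<close> keeps \<open>c\<close> away from
    \<open>1\<close>, so that the piece lies in \<open>R_space A\<close>.\<close>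
  have c1: "c \<noteq> 1"
    using cs by (auto simp: power2_eq_square)
  have lin: "linear ((*v) A)" by simp
  have im: "im_vec z = (1 / s) *\<^sub>R (c *\<^sub>R re_vec z - A *v re_vec z)" if "z \<in> ?E" for z
    using that cs by (simp add: ceig_space_iff c_def s_def)
  have re: "re_vec z \<in> ?W" if "z \<in> ?E" for z
  proof -
    have x: "A *v re_vec z = c *\<^sub>R re_vec z - s *\<^sub>R im_vec z"
      and y: "A *v im_vec z = s *\<^sub>R re_vec z + c *\<^sub>R im_vec z"
      using that by (auto simp: ceig_space_iff c_def s_def)
    have "A *v (A *v re_vec z) + re_vec z
        = (c\<^sup>2 - s\<^sup>2 + 1) *\<^sub>R re_vec z - (2 * c * s) *\<^sub>R im_vec z"
      unfolding x linear_diff[OF lin] linear_scale[OF lin] y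
      by (simp add: vec_eq_iff algebra_simps power2_eq_square)
    also have "c\<^sup>2 - s\<^sup>2 + 1 = 2 * c\<^sup>2" using cs by simp
    also have "(2 * c\<^sup>2) *\<^sub>R re_vec z - (2 * c * s) *\<^sub>R im_vec z = (2 * c) *\<^sub>R (A *v re_vec z)"
      unfolding x by (simp add: vec_eq_iff algebra_simps power2_eq_square)
    finally show ?thesis by (simp add: rot_space_def)
  qed
  have surj: "x \<in> re_vec ` ?E" if x: "x \<in> ?W" for x
  proof -
    \<comment> \<open>The first eigenvector equation leaves this as the only candidate for the
      imaginary part.\<close>
    define y where "y = (1 / s) *\<^sub>R (c *\<^sub>R x - A *v x)"
    define z where "z = (\<chi> i. Complex (x $ i) (y $ i))"
    have xy: "re_vec z = x" "im_vec z = y" by (simp_all add: z_def re_vec_def im_vec_def)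
    have "y \<in> ?W"
      unfolding y_def using x lin by (intro subspace_scale subspace_diff subspace_rot_space rot_space_closed)
    then have "x \<in> R_space A" "y \<in> R_space A"
      using rot_space_subset_R_space[OF A c1] x by auto
    moreover have sy: "A *v x = c *\<^sub>R x - s *\<^sub>R y"
      using cs by (simp add: y_def)
    moreover have "A *v y = s *\<^sub>R x + c *\<^sub>R y"
    proof -
      have AA: "A *v (A *v x) = (2 * c) *\<^sub>R (A *v x) - x"
        using x by (simp add: rot_space_def algebra_simps)
      have "s *\<^sub>R (A *v y) = c *\<^sub>R (A *v x) - A *v (A *v x)"
        using cs by (simp add: y_def linear_diff[OF lin] linear_scale[OF lin])
      also have "\<dots> = x - c *\<^sub>R (A *v x)"
        unfolding AA by (simp add: vec_eq_iff algebra_simps)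
      also have "\<dots> = (1 - c\<^sup>2) *\<^sub>R x + (c * s) *\<^sub>R y"
        unfolding sy by (simp add: vec_eq_iff algebra_simps power2_eq_square)
      also have "1 - c\<^sup>2 = s * s" using cs by (simp add: power2_eq_square)
      finally have "s *\<^sub>R (A *v y) = s *\<^sub>R (s *\<^sub>R x + c *\<^sub>R y)"
        by (simp add: algebra_simps)
      then show ?thesis using cs by simp
    qed
    ultimately have "z \<in> ?E"
      by (simp add: ceig_space_iff xy flip: c_def s_def)
    then show ?thesis using xy by blast
  qed
  have subE: "subspace ?E"
    by (intro vec_subspace_imp_subspace vec_subspace_ceig_space subspace_R_space)
  have "inj_on re_vec ?E"
  proof (rule inj_onI)
    fix z w assume "z \<in> ?E" "w \<in> ?E" "re_vec z = re_vec w"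
    moreover from this have "im_vec z = im_vec w" using im by simp
    ultimately show "z = w"
      by (simp add: vec_eq_iff re_vec_def im_vec_def complex_eq_iff)
  qed
  then have "dim (re_vec ` ?E) = dim ?E"
    using subE by (intro dim_image_eq linear_re_vec) (simp add: span_eq_iff[THEN iffD2])
  moreover have "re_vec ` ?E = ?W" using re surj by blast
  ultimately show ?thesis
    using dim_eq_twice_vec_dim[OF vec_subspace_ceig_space[OF subspace_R_space]]
    by (simp add: c_def)
qed

text \<open>Eigenvalues have modulus \<open>1\<close>; on the unit circle the two dimensions vanish
  together by \<open>dim_ceig_space\<close>.\<close>

lemma ceig_space_nontrivial_iff:
  assumes A: "orthogonal_matrix A" and l: "Im l > 0"
  shows "ceig_space A (R_space A) l \<noteq> {0} \<longleftrightarrow>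
    (Re l)\<^sup>2 + (Im l)\<^sup>2 = 1 \<and> rot_space ((*v) A) (Re l) \<noteq> {0}"
proof -
  have E0: "0 \<in> ceig_space A (R_space A) l"
    using vec_subspace_ceig_space[OF subspace_R_space] vec.subspace_0 by blast
  have W0: "0 \<in> rot_space ((*v) A) (Re l)"
    by (rule zero_in_rot_space) simp
  have *: "(ceig_space A (R_space A) l = {0}) = (rot_space ((*v) A) (Re l) = {0})"
    if u: "(Re l)\<^sup>2 + (Im l)\<^sup>2 = 1"
  proof -
    have "dim (ceig_space A (R_space A) l) = dim (rot_space ((*v) A) (Re l))"
      using dim_ceig_space[OF A u l] dim_eq_twice_vec_dim[OF vec_subspace_ceig_space[OF subspace_R_space]]
      by simp
    then have "ceig_space A (R_space A) l \<subseteq> {0} \<longleftrightarrow> rot_space ((*v) A) (Re l) \<subseteq> {0}"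
      by (metis dim_eq_0)
    then show ?thesis using E0 W0 by blast
  qed
  show ?thesis
    using * ceig_space_unit[OF A, of _ "R_space A" l] E0 by blast
qed

text \<open>Eigenvalues in the open upper half-plane lie on the unit circle, where the real part is
  a bijection onto the open interval from \<open>-1\<close> to \<open>1\<close>. So they correspond
  to the indices \<open>c\<close> of the complex pieces.\<close>

lemma rot_dims_segre:
  assumes A: "orthogonal_matrix A"
  shows "rot_dims ((*v) A) = image_mset ((*) 2) (segre_nonreal A)"
proof -
  let ?S = "{l. Im l > 0 \<and> ceig_space A (R_space A) l \<noteq> {0}}"
  let ?C = "{c. \<bar>c\<bar> < 1 \<and> rot_space ((*v) A) c \<noteq> {0}}"
  have S: "?S = {l. Im l > 0 \<and> (Re l)\<^sup>2 + (Im l)\<^sup>2 = 1 \<and> rot_space ((*v) A) (Re l) \<noteq> {0}}"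
    using ceig_space_nontrivial_iff[OF A] by blast
  have inj: "inj_on Re ?S"
    unfolding S
  proof (rule inj_onI, clarsimp)
    fix x y :: complex
    assume *: "Im x > 0" "Im y > 0" "(Re y)\<^sup>2 + (Im x)\<^sup>2 = 1" "(Re y)\<^sup>2 + (Im y)\<^sup>2 = 1" "Re x = Re y"
    then have "(Im x)\<^sup>2 = (Im y)\<^sup>2" by linarith
    then have "Im x = Im y" by (rule power2_eq_imp_eq) (use * in auto)
    then show "x = y" using * by (simp add: complex_eq_iff)
  qed
  have "Re ` ?S = ?C"
    unfolding S
  proof (intro subset_antisym subsetI; clarsimp)
    fix l :: complex assume "Im l > 0" "(Re l)\<^sup>2 + (Im l)\<^sup>2 = 1"
    then have "(Re l)\<^sup>2 < 1" by (smt (verit) zero_less_power)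
    then show "\<bar>Re l\<bar> < 1" by (simp add: abs_square_less_1)
  next
    fix c :: real assume c: "\<bar>c\<bar> < 1" "rot_space ((*v) A) c \<noteq> {0}"
    then have "c\<^sup>2 < 1" by (simp add: abs_square_less_1)
    \<comment> \<open>The witness is the upper of the two points of the unit circle with real part
      \<open>c\<close>.\<close>
    then show "c \<in> Re ` {l. 0 < Im l \<and> (Re l)\<^sup>2 + (Im l)\<^sup>2 = 1 \<and> rot_space ((*v) A) (Re l) \<noteq> {0}}"
      using c by (intro image_eqI[of _ _ "Complex c (sqrt (1 - c\<^sup>2))"]) auto
  qed
  then have "rot_dims ((*v) A) = image_mset (\<lambda>c. dim (rot_space ((*v) A) c)) (image_mset Re (mset_set ?S))"
    using inj by (simp add: rot_dims_def image_mset_mset_set)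
  also have "\<dots> = image_mset (\<lambda>l. dim (rot_space ((*v) A) (Re l))) (mset_set ?S)"
    by (simp add: multiset.map_comp comp_def)
  also have "\<dots> = image_mset (\<lambda>l. 2 * vec.dim (ceig_space A (R_space A) l)) (mset_set ?S)"
  proof (rule image_mset_cong)
    fix l assume "l \<in># mset_set ?S"
    then have "l \<in> ?S"
      by (metis elem_mset_set mset_set.infinite set_mset_empty empty_iff)
    then show "dim (rot_space ((*v) A) (Re l)) = 2 * vec.dim (ceig_space A (R_space A) l)"
      unfolding S using dim_ceig_space[OF A] by blast
  qed
  also have "\<dots> = image_mset ((*) 2) (segre_nonreal A)"
    by (simp add: segre_nonreal_def multiset.map_comp comp_def)
  finally show ?thesis .
qed

lemma segre_nonreal_eq_iff:
  assumes "orthogonal_matrix A" "orthogonal_matrix A'"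
  shows "segre_nonreal A = segre_nonreal A' \<longleftrightarrow> rot_dims ((*v) A) = rot_dims ((*v) A')"
proof -
  have "inj ((*) (2::nat))" by (auto simp: inj_on_def)
  then show ?thesis
    using assms multiset.inj_map[of "(*) (2::nat)"] by (auto simp: rot_dims_segre dest: injD)
qed

lemma if_zero_mset_eq_iff:
  "(if a = 0 then {#} else {#a#}) = (if b = 0 then {#} else {#b#}) \<longleftrightarrow> a = (b :: nat)"
  by auto

text \<open>The eigenvalue \<open>1\<close> does not occur on \<open>R_space A\<close>, and the
  eigenspace for \<open>-1\<close> lies entirely inside it. Hence \<open>segre_real\<close> has at
  most one entry, and a missing entry stands for dimension zero.\<close>

lemma segre_real_eq_iff:
  assumes "orthogonal_matrix A" "orthogonal_matrix A'"
  shows "segre_real A = segre_real A' \<longleftrightarrow>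
    dim (rot_space ((*v) A) (-1)) = dim (rot_space ((*v) A') (-1))"
proof -
  have *: "segre_real A = (if dim (rot_space ((*v) A) (-1)) = 0 then {#}
      else {#dim (rot_space ((*v) A) (-1))#})"
    if A: "orthogonal_matrix A" for A :: "real^'n^'n"
  proof -
    have f: "orthogonal_transformation ((*v) A)"
      using A by (simp add: orthogonal_transformation_matrix_mult)
    have 1: "reig_space A (R_space A) 1 = {0}"
      by (auto simp: reig_space_def R_space_def)
    have 2: "reig_space A (R_space A) (-1) = rot_space ((*v) A) (-1)"
      using rot_space_subset_R_space[OF A, of "-1"]
      by (auto simp: reig_space_def rot_space_minus_one[OF f])
    have "0 \<in> rot_space ((*v) A) (-1)" by (rule zero_in_rot_space) simp
    then have 3: "dim (rot_space ((*v) A) (-1)) = 0 \<longleftrightarrow> rot_space ((*v) A) (-1) = {0}"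
      by auto
    have "{\<epsilon> \<in> {1, -1}. reig_space A (R_space A) \<epsilon> \<noteq> {0}}
        = (if rot_space ((*v) A) (-1) = {0} then {} else {-1})"
      using 1 2 by auto
    then show ?thesis
      unfolding segre_real_def using 2 3 by simp
  qed
  show ?thesis
    unfolding *[OF assms(1)] *[OF assms(2)] by (rule if_zero_mset_eq_iff)
qed

section \<open>Centralizers in the Euclidean group\<close>

declare transpose_matrix_vector [simp del]

lemma orthogonal_matrix_cancel:
  assumes "orthogonal_matrix (P :: real^'n^'n)"
  shows "P *v (transpose P *v x) = x" "transpose P *v (P *v x) = x"
  using assms by (simp_all add: matrix_vector_mul_assoc orthogonal_matrix_def)

section \<open>Conjugation in the Euclidean group\<close>

definition euc_conj :: "('n::finite) euc \<Rightarrow> 'n euc \<Rightarrow> 'n euc" where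
  "euc_conj h k = euc_mult (euc_mult h k) (euc_inv h)"

lemma euc_mult_assoc: "euc_mult (euc_mult f g) h = euc_mult f (euc_mult g h)"
  by (simp add: euc_mult_def matrix_mul_assoc matrix_vector_mul_assoc matrix_vector_right_distrib add.assoc)

lemma euc_mult_one: "euc_mult (mat 1, 0) f = f" "euc_mult f (mat 1, 0) = f"
  by (simp_all add: euc_mult_def)

lemma euc_mult_inv:
  assumes "h \<in> Euc"
  shows "euc_mult h (euc_inv h) = (mat 1, 0)" "euc_mult (euc_inv h) h = (mat 1, 0)"
proof -
  have "fst h ** transpose (fst h) = mat 1" "transpose (fst h) ** fst h = mat 1"
    using assms by (auto simp: Euc_def orthogonal_matrix_def)
  then show "euc_mult h (euc_inv h) = (mat 1, 0)" "euc_mult (euc_inv h) h = (mat 1, 0)"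
    by (simp_all add: euc_mult_def euc_inv_def matrix_vector_mul_assoc
        linear_neg[OF matrix_vector_mul_linear])
qed

lemma euc_inv_mem: "h \<in> Euc \<Longrightarrow> euc_inv h \<in> Euc"
  by (auto simp: Euc_def euc_inv_def orthogonal_matrix_def)

lemma euc_mult_mem: "h \<in> Euc \<Longrightarrow> k \<in> Euc \<Longrightarrow> euc_mult h k \<in> Euc"
  by (auto simp: Euc_def euc_mult_def orthogonal_matrix_mul)

lemma euc_inv_unique:
  assumes "h \<in> Euc" "euc_mult h k = (mat 1, 0)"
  shows "k = euc_inv h"
  by (metis assms euc_mult_assoc euc_mult_inv(2) euc_mult_one)

lemma euc_inv_mult:
  assumes "h \<in> Euc" "k \<in> Euc"
  shows "euc_inv (euc_mult h k) = euc_mult (euc_inv k) (euc_inv h)"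
proof (rule euc_inv_unique[symmetric])
  have "euc_mult (euc_mult h k) (euc_mult (euc_inv k) (euc_inv h))
      = euc_mult h (euc_mult (euc_mult k (euc_inv k)) (euc_inv h))"
    by (simp only: euc_mult_assoc)
  then show "euc_mult (euc_mult h k) (euc_mult (euc_inv k) (euc_inv h)) = (mat 1, 0)"
    using assms by (simp add: euc_mult_inv euc_mult_one)
qed (use assms in \<open>rule euc_mult_mem\<close>)

lemma euc_conj_mem: "h \<in> Euc \<Longrightarrow> k \<in> Euc \<Longrightarrow> euc_conj h k \<in> Euc"
  by (simp add: euc_conj_def euc_mult_mem euc_inv_mem)

lemma euc_conj_conj:
  assumes "h \<in> Euc" "k \<in> Euc"
  shows "euc_conj h (euc_conj k x) = euc_conj (euc_mult h k) x"
  using assms by (simp add: euc_conj_def euc_inv_mult euc_mult_assoc)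

lemma euc_conj_one: "euc_conj (mat 1, 0) x = x"
  by (simp add: euc_conj_def euc_inv_def euc_mult_one transpose_mat)

lemma euc_conj_inv:
  assumes "h \<in> Euc"
  shows "euc_conj (euc_inv h) (euc_conj h x) = x" "euc_conj h (euc_conj (euc_inv h) x) = x"
  using assms by (simp_all add: euc_conj_conj euc_inv_mem euc_mult_inv euc_conj_one)

lemma euc_conj_mult:
  assumes "h \<in> Euc"
  shows "euc_conj h (euc_mult x y) = euc_mult (euc_conj h x) (euc_conj h y)"
proof -
  have "euc_mult (euc_conj h x) (euc_conj h y)
      = euc_mult (euc_mult h (euc_mult x (euc_mult (euc_mult (euc_inv h) h) y))) (euc_inv h)"
    by (simp only: euc_conj_def euc_mult_assoc)
  then show ?thesis
    using assms by (simp add: euc_mult_inv euc_mult_one euc_conj_def)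
qed

section \<open>Conjugate subgroups and centralizers\<close>

lemma conjugate_subgroups_iff:
  "conjugate_subgroups H K \<longleftrightarrow> (\<exists>h\<in>Euc. euc_conj h ` H = K)"
  by (simp add: conjugate_subgroups_def euc_conj_def)

lemma conjugate_subgroups_sym:
  assumes "conjugate_subgroups H K"
  shows "conjugate_subgroups K H"
proof -
  obtain h where h: "h \<in> Euc" "euc_conj h ` H = K"
    using assms by (auto simp: conjugate_subgroups_iff)
  have "euc_conj (euc_inv h) ` K = H"
    unfolding h(2)[symmetric] by (simp add: image_image euc_conj_inv[OF h(1)])
  then show ?thesis
    unfolding conjugate_subgroups_iff using euc_inv_mem[OF h(1)] by blast
qed

lemma conjugate_subgroups_trans:
  assumes "conjugate_subgroups H K" "conjugate_subgroups K L"
  shows "conjugate_subgroups H L"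
proof -
  obtain h k where h: "h \<in> Euc" "euc_conj h ` H = K" and k: "k \<in> Euc" "euc_conj k ` K = L"
    using assms by (auto simp: conjugate_subgroups_iff)
  have "euc_conj (euc_mult k h) ` H = L"
    unfolding h(2)[symmetric] k(2)[symmetric] by (simp add: image_image euc_conj_conj[OF k(1) h(1)])
  then show ?thesis
    unfolding conjugate_subgroups_iff using euc_mult_mem[OF k(1) h(1)] by blast
qed

lemma centralizer_conj_subset:
  assumes "h \<in> Euc"
  shows "euc_conj h ` centralizer f \<subseteq> centralizer (euc_conj h f)"
  using assms by (auto simp: centralizer_def euc_conj_mem simp flip: euc_conj_mult[OF assms])

text \<open>\<open>centralizer_conj_subset\<close> is applied to \<open>h\<close> and to its
  inverse, the latter giving the reverse inclusion.\<close>

lemma conjugate_centralizer_conj: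
  assumes h: "h \<in> Euc"
  shows "conjugate_subgroups (centralizer f) (centralizer (euc_conj h f))"
proof -
  have "centralizer (euc_conj h f) \<subseteq> euc_conj h ` centralizer f"
  proof
    fix k assume "k \<in> centralizer (euc_conj h f)"
    then have "euc_conj (euc_inv h) k \<in> centralizer f"
      using centralizer_conj_subset[OF euc_inv_mem[OF h], of "euc_conj h f"] euc_conj_inv(1)[OF h]
      by auto
    then show "k \<in> euc_conj h ` centralizer f"
      using euc_conj_inv(2)[OF h] by (metis imageI)
  qed
  then have "euc_conj h ` centralizer f = centralizer (euc_conj h f)"
    using centralizer_conj_subset[OF h] by blast
  then show ?thesis
    using h by (auto simp: conjugate_subgroups_iff)
qed

text \<open>\<open>a\<close> is split along the range of \<open>1 - A\<close> and its orthogonal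
  complement. A vector \<open>z\<close> of the complement is orthogonal to \<open>z - A z\<close>;
  as \<open>z\<close> and \<open>A z\<close> have equal norms, \<open>A z = z\<close>. The term
  \<open>p - A p\<close> is what conjugation by the translation \<open>p\<close> adds.\<close>

lemma translation_decomposition:
  fixes A :: "real^'n::finite^'n"
  assumes A: "orthogonal_matrix A"
  obtains a0 p where "A *v a0 = a0" "a = a0 + (p - A *v p)"
proof -
  let ?R = "range (\<lambda>p. p - A *v p)"
  have f: "orthogonal_transformation ((*v) A)"
    using A by (rule orthogonal_transformation_matrix_mult)
  have "subspace ?R"
    by (intro linear_subspace_image subspace_UNIV linear_compose_sub linear_ident) simp
  then have R: "span ?R = ?R" by (rule span_eq_iff[THEN iffD2])
  obtain y z where yz: "y \<in> ?R" "\<And>w. w \<in> ?R \<Longrightarrow> orthogonal z w" "a = y + z"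
    using orthogonal_subspace_decomp_exists[of ?R a] unfolding R by metis
  have "z \<bullet> (z - A *v z) = 0"
    using yz(2)[of "z - A *v z"] by (simp add: orthogonal_def)
  moreover have "(A *v z) \<bullet> (A *v z) = z \<bullet> z"
    using f by (simp add: orthogonal_transformation_def)
  ultimately have "(A *v z - z) \<bullet> (A *v z - z) = 0"
    by (simp add: inner_diff_left inner_diff_right inner_commute)
  then have "A *v z = z" by simp
  then show thesis
    using that yz by (auto simp: add.commute)
qed

text \<open>Separates fixed vectors from displacements: a vector that is both is orthogonal to
  itself and vanishes.\<close>

lemma fixed_inner_displacement:
  fixes A :: "real^'n::finite^'n"
  assumes A: "orthogonal_matrix A" and "A *v u = u"
  shows "u \<bullet> (x - A *v x) = 0"
proof -
  have "(A *v u) \<bullet> (A *v x) = u \<bullet> x"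
    using orthogonal_transformation_matrix_mult[OF A] by (simp add: orthogonal_transformation_def)
  then show ?thesis
    using assms(2) by (simp add: inner_diff_right)
qed

text \<open>The shear \<open>h\<close> reduces to \<open>p = 0\<close>. Then
  \<open>A w + s a0 = w\<close> equates the fixed vector \<open>s a0\<close> with a displacement, so
  both vanish. The kernel is the fixed space of \<open>A\<close>, with a free coordinate
  \<open>s\<close> exactly if \<open>a0 = 0\<close>.\<close>

lemma elliptic_iff:
  fixes A :: "real^'n::finite^'n"
  assumes A: "orthogonal_matrix A" and a0: "A *v a0 = a0"
  shows "elliptic (A, a0 + (p - A *v p)) \<longleftrightarrow> a0 = 0"
proof -
  define W where "W = {v. A *v v = v}"
  have W: "subspace W"
    by (auto simp: W_def subspace_def matrix_vector_right_distrib matrix_vector_mult_scaleR)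
  let ?a = "a0 + (p - A *v p)"
  let ?D = "{q :: (real^'n) \<times> real. A *v fst q + snd q *\<^sub>R ?a = fst q}"
  define h where "h q = (fst q + snd q *\<^sub>R p, snd q)" for q :: "(real^'n) \<times> real"
  have lin: "linear h"
    by (rule linearI) (auto simp: h_def algebra_simps)
  have inj: "inj h"
    by (rule injI) (auto simp: h_def prod_eq_iff)
  have mem: "h (w, s) \<in> ?D \<longleftrightarrow> A *v w + s *\<^sub>R a0 = w" for w s
    by (simp add: h_def matrix_vector_right_distrib matrix_vector_mult_scaleR
        scaleR_right_diff_distrib scaleR_right_distrib algebra_simps)
  have iff: "A *v w + s *\<^sub>R a0 = w \<longleftrightarrow> A *v w = w \<and> s *\<^sub>R a0 = 0" for w s
  proof
    assume *: "A *v w + s *\<^sub>R a0 = w"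
    then have "s *\<^sub>R a0 = w - A *v w" by (simp add: algebra_simps)
    moreover have "A *v (s *\<^sub>R a0) = s *\<^sub>R a0" using a0 by (simp add: matrix_vector_mult_scaleR)
    ultimately have "s *\<^sub>R a0 = 0"
      using fixed_inner_displacement[OF A, of "s *\<^sub>R a0" w] by (metis inner_eq_zero_iff)
    moreover from this have "A *v w = w" using * by (simp only: add_0_right)
    ultimately show "A *v w = w \<and> s *\<^sub>R a0 = 0" by blast
  qed (metis add_0_right)
  have memD: "h x \<in> ?D \<longleftrightarrow> x \<in> W \<times> (if a0 = 0 then UNIV else {0})" for x
  proof -
    obtain w s where x: "x = (w, s)" by fastforce
    show ?thesis unfolding x mem iff by (auto simp: W_def)
  qed
  have surj: "\<exists>x. q = h x" for q
    by (rule exI[of _ "(fst q - snd q *\<^sub>R p, snd q)"]) (simp add: h_def)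
  have D: "?D = h ` (W \<times> (if a0 = 0 then UNIV else {0}))" (is "_ = h ` ?T")
  proof
    show "?D \<subseteq> h ` ?T"
    proof
      fix q assume q: "q \<in> ?D"
      obtain x where x: "q = h x" using surj by blast
      show "q \<in> h ` ?T" using q unfolding x memD by (rule imageI)
    qed
    show "h ` ?T \<subseteq> ?D"
      by (rule image_subsetI) (simp only: memD)
  qed
  have "d_dim (A, ?a) = dim (W \<times> (if a0 = 0 then UNIV else {0::real}))"
    unfolding d_dim_def fst_conv snd_conv D
    using lin inj by (intro dim_image_eq) (auto intro: inj_on_subset)
  also have "\<dots> = dim W + (if a0 = 0 then 1 else 0)"
    using W by (simp add: dim_Times)
  finally show ?thesis
    by (simp add: elliptic_def r_dim_def W_def)
qed

text \<open>For commuting elements \<open>B a - a = A b - b\<close>. The left side is fixed by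
  \<open>A\<close> and the right side is a displacement up to sign, so both are zero.\<close>

lemma centralizer_normal_iff:
  fixes A :: "real^'n::finite^'n"
  assumes A: "orthogonal_matrix A" and a: "A *v a = a"
  shows "(B, b) \<in> centralizer (A, a) \<longleftrightarrow>
    orthogonal_matrix B \<and> (\<forall>x. B *v (A *v x) = A *v (B *v x)) \<and> B *v a = a \<and> A *v b = b"
proof -
  have eq: "B ** A = A ** B \<longleftrightarrow> (\<forall>x. B *v (A *v x) = A *v (B *v x))"
    by (simp add: matrix_eq matrix_vector_mul_assoc)
  have "B *v a = a \<and> A *v b = b"
    if comm: "\<forall>x. B *v (A *v x) = A *v (B *v x)" and *: "B *v a + b = A *v b + a"
  proof -
    define u where "u = B *v a - a"
    have "A *v u = u"
      using comm[rule_format, of a] a by (simp add: u_def matrix_vector_mult_diff_distrib)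
    moreover have "u = - (b - A *v b)"
      using * by (simp add: u_def algebra_simps)
    ultimately have "u \<bullet> u = 0"
      using fixed_inner_displacement[OF A, of u b] by (metis inner_minus_right neg_equal_0_iff_equal)
    then have "u = 0" by simp
    then show ?thesis using * by (simp add: u_def)
  qed
  then show ?thesis
    using a by (auto simp: centralizer_def Euc_def euc_mult_def eq add.commute)
qed

lemma euc_conj_linear_part:
  "euc_conj (P, 0) (B, b) = (P ** B ** transpose P, P *v b)"
  by (simp add: euc_conj_def euc_mult_def euc_inv_def)

text \<open>One inclusion, phrased so that it applies both to \<open>P\<close> and to its transpose.
  The scalar \<open>t\<close> absorbs the different lengths of \<open>a\<close> and
  \<open>a'\<close>: whatever fixes \<open>a\<close> fixes its multiples.\<close>

lemma centralizer_transfer: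
  fixes A A' P :: "real^'n::finite^'n"
  assumes A: "orthogonal_matrix A" "A *v a = a" and A': "orthogonal_matrix A'" "A' *v a' = a'"
    and P: "orthogonal_matrix P" and tw: "intertwines ((*v) A) ((*v) A') ((*v) P)"
    and fixed: "\<And>x. A *v x = x \<Longrightarrow> A' *v (P *v x) = P *v x"
    and t: "transpose P *v a' = t *\<^sub>R a" and inv: "inv ((*v) P) = (*v) (transpose P)"
    and k: "k \<in> centralizer (A, a)"
  shows "euc_conj (P, 0) k \<in> centralizer (A', a')"
proof -
  obtain B b where kB: "k = (B, b)" by fastforce
  have B: "orthogonal_matrix B" "\<And>x. B *v (A *v x) = A *v (B *v x)" "B *v a = a" "A *v b = b"
    using k unfolding kB centralizer_normal_iff[OF A] by auto
  note PP = orthogonal_matrix_cancel[OF P]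
  show ?thesis
    unfolding kB euc_conj_linear_part centralizer_normal_iff[OF A']
  proof (intro conjI allI)
    show "orthogonal_matrix (P ** B ** transpose P)"
      using B P by (intro orthogonal_matrix_mul) (auto simp: orthogonal_matrix_def)
    show "(P ** B ** transpose P) *v (A' *v x) = A' *v ((P ** B ** transpose P) *v x)" for x
      using intertwines_commute[OF orthogonal_transformation_matrix_mult[OF A(1)]
        orthogonal_transformation_matrix_mult[OF A'(1)] orthogonal_transformation_matrix_mult[OF P]
        tw matrix_vector_mul_linear B(2), of x]
      by (simp add: inv matrix_vector_mul_assoc[symmetric])
    have "(P ** B ** transpose P) *v a' = P *v (B *v (t *\<^sub>R a))"
      by (simp add: t matrix_vector_mul_assoc[symmetric])
    also have "B *v (t *\<^sub>R a) = transpose P *v a'"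
      using B(3) by (simp add: t matrix_vector_mult_scaleR)
    finally show "(P ** B ** transpose P) *v a' = a'" by (simp add: PP)
    show "A' *v (P *v b) = P *v b" using fixed B(4) .
  qed
qed

lemma inv_orthogonal_matrix:
  assumes "orthogonal_matrix (P :: real^'n::finite^'n)"
  shows "inv ((*v) P) = (*v) (transpose P)"
  using assms
  by (intro inv_unique_comp) (auto simp: fun_eq_iff orthogonal_matrix_def matrix_vector_mul_assoc)

text \<open>The isometry from \<open>exists_intertwiner\<close> carries each centralizer into the
  other, by \<open>centralizer_transfer\<close> used once for \<open>P\<close> and once for its
  transpose.\<close>

lemma conjugate_centralizers_if:
  fixes A A' :: "real^'n::finite^'n"
  assumes A: "orthogonal_matrix A" "A *v a = a" and A': "orthogonal_matrix A'" "A' *v a' = a'"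
    and zero: "a = 0 \<longleftrightarrow> a' = 0"
    and d1: "dim (rot_space ((*v) A) 1) = dim (rot_space ((*v) A') 1)"
    and dm1: "dim (rot_space ((*v) A) (-1)) = dim (rot_space ((*v) A') (-1))"
    and dims: "rot_dims ((*v) A) = rot_dims ((*v) A')"
  shows "conjugate_subgroups (centralizer (A, a)) (centralizer (A', a'))"
proof -
  have f: "orthogonal_transformation ((*v) A)" and f': "orthogonal_transformation ((*v) A')"
    using A A' by (auto intro: orthogonal_transformation_matrix_mult)
  \<comment> \<open>Scaling by \<open>t\<close> gives \<open>a'\<close> the norm of
    \<open>a\<close>; the value \<open>1\<close> for vanishing \<open>a\<close> keeps
    \<open>t\<close> invertible.\<close>
  define t where "t = (if a = 0 then 1 else norm a / norm a')"
  have t: "t \<noteq> 0" "norm a = norm (t *\<^sub>R a')" "A' *v (t *\<^sub>R a') = t *\<^sub>R a'"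
    using zero A' by (auto simp: t_def matrix_vector_mult_scaleR)
  obtain \<phi> where \<phi>: "orthogonal_transformation \<phi>" "\<phi> a = t *\<^sub>R a'"
    "\<phi> ` rot_space ((*v) A) 1 = rot_space ((*v) A') 1"
    "intertwines ((*v) A) ((*v) A') \<phi>" "intertwines ((*v) A') ((*v) A) (inv \<phi>)"
    using exists_intertwiner[OF f f' A(2) t(3) t(2) d1 dm1 dims] by metis
  define P where "P = matrix \<phi>"
  have P: "orthogonal_matrix P" and \<phi>P: "\<phi> = (*v) P"
    using \<phi>(1) by (auto simp: P_def orthogonal_transformation_matrix matrix_works fun_eq_iff)
  have PT: "orthogonal_matrix (transpose P)" and inv: "inv \<phi> = (*v) (transpose P)"
    using P inv_orthogonal_matrix[OF P] by (auto simp: orthogonal_matrix_def \<phi>P)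
  have inv': "inv ((*v) (transpose P)) = (*v) (transpose (transpose P))"
    using inv_orthogonal_matrix[OF PT] .
  note PP = orthogonal_matrix_cancel[OF P]
  have fixed: "A' *v (P *v x) = P *v x" if "A *v x = x" for x
    using that \<phi>(3) unfolding rot_space_one[OF f] rot_space_one[OF f'] \<phi>P by blast
  have fixed': "A *v (transpose P *v x) = transpose P *v x" if "A' *v x = x" for x
  proof -
    have "x \<in> (*v) P ` {v. A *v v = v}"
      using that \<phi>(3) unfolding rot_space_one[OF f] rot_space_one[OF f'] \<phi>P by blast
    then show ?thesis using PP by auto
  qed
  have Pa: "transpose (transpose P) *v a = t *\<^sub>R a'" using \<phi>(2) by (simp add: \<phi>P)
  then have "t *\<^sub>R (transpose P *v a') = a"
    using PP(2)[of a] by (simp add: matrix_vector_mult_scaleR)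
  then have PTa: "transpose P *v a' = (1 / t) *\<^sub>R a"
    using t(1) by auto
  have hE: "(P, 0) \<in> Euc" using P by (simp add: Euc_def)
  have "euc_conj (P, 0) ` centralizer (A, a) = centralizer (A', a')"
  proof
    show "euc_conj (P, 0) ` centralizer (A, a) \<subseteq> centralizer (A', a')"
      using centralizer_transfer[OF A A' P \<phi>(4)[unfolded \<phi>P] fixed PTa inv[unfolded \<phi>P]] by blast
    show "centralizer (A', a') \<subseteq> euc_conj (P, 0) ` centralizer (A, a)"
    proof
      fix k assume "k \<in> centralizer (A', a')"
      then have "euc_conj (transpose P, 0) k \<in> centralizer (A, a)"
        using centralizer_transfer[OF A' A PT \<phi>(5)[unfolded inv] fixed' Pa inv'] by blast
      moreover have "euc_conj (P, 0) (euc_conj (transpose P, 0) k) = k"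
        using euc_conj_inv(2)[OF hE, of k] by (simp add: euc_inv_def)
      ultimately show "k \<in> euc_conj (P, 0) ` centralizer (A, a)"
        by (metis imageI)
    qed
  qed
  then show ?thesis
    using hE by (auto simp: conjugate_subgroups_iff)
qed

text \<open>After \<open>A'\<close> and \<open>a'\<close> are pulled back along \<open>P\<close> to
  \<open>g\<close> and \<open>b\<close>, equality of the linear parts of the centralizers gives
  \<open>same\<close>, and their pure translations give \<open>fix_iff\<close>. Then
  \<open>rot_spaces_eq\<close> applies, and dimensions are carried back by \<open>P\<close>.\<close>

lemma conjugate_centralizers_only_if:
  fixes A A' :: "real^'n::finite^'n"
  assumes A: "orthogonal_matrix A" "A *v a = a" and A': "orthogonal_matrix A'" "A' *v a' = a'"
    and conj: "conjugate_subgroups (centralizer (A, a)) (centralizer (A', a'))"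
  shows "a = 0 \<longleftrightarrow> a' = 0"
    and "dim (rot_space ((*v) A) 1) = dim (rot_space ((*v) A') 1)"
    and "dim (rot_space ((*v) A) (-1)) = dim (rot_space ((*v) A') (-1))"
    and "rot_dims ((*v) A) = rot_dims ((*v) A')"
proof -
  obtain h where h: "h \<in> Euc" "euc_conj h ` centralizer (A, a) = centralizer (A', a')"
    using conj by (auto simp: conjugate_subgroups_iff)
  obtain P p where hP: "h = (P, p)" by fastforce
  have P: "orthogonal_matrix P" using h(1) by (simp add: hP Euc_def)
  note PP = orthogonal_matrix_cancel[OF P]
  have mem: "euc_conj h k \<in> centralizer (A', a') \<longleftrightarrow> k \<in> centralizer (A, a)" for k
  proof -
    have "inj (euc_conj h)"
      by (rule inj_on_inverseI) (rule euc_conj_inv(1)[OF h(1)])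
    then show ?thesis
      unfolding h(2)[symmetric] by (rule inj_image_mem_iff)
  qed
  \<comment> \<open>Only the translation part involves \<open>p\<close>; linear parts are conjugated
    by \<open>P\<close> alone.\<close>
  have conj_eq: "euc_conj h (B, b) = (P ** B ** transpose P,
      P *v b + p - P *v (B *v (transpose P *v p)))" for B b
    by (simp add: hP euc_conj_def euc_mult_def euc_inv_def matrix_vector_mul_assoc[symmetric]
        linear_neg[OF matrix_vector_mul_linear])
  define g where "g x = transpose P *v (A' *v (P *v x))" for x
  define b where "b = transpose P *v a'"
  have f: "orthogonal_transformation ((*v) A)" and f': "orthogonal_transformation ((*v) A')"
    and oP: "orthogonal_transformation ((*v) P)"
    using A A' P by (auto intro: orthogonal_transformation_matrix_mult)
  have "orthogonal_transformation ((*v) (transpose P))"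
    using P by (intro orthogonal_transformation_matrix_mult) (auto simp: orthogonal_matrix_def)
  then have "orthogonal_transformation ((*v) (transpose P) \<circ> ((*v) A' \<circ> (*v) P))"
    using f' oP by (intro orthogonal_transformation_compose)
  then have g: "orthogonal_transformation g"
    by (simp add: g_def[abs_def] comp_def)
  have gb: "g b = b" by (simp add: g_def b_def PP A')
  have Pg: "P *v g x = A' *v (P *v x)" for x by (simp add: g_def PP)
  have fix_iff: "A *v x = x \<longleftrightarrow> g x = x" for x
  proof -
    have one: "orthogonal_matrix (mat 1 :: real^'n^'n)"
      by (simp add: orthogonal_matrix_def transpose_mat)
    \<comment> \<open>A translation lies in the centralizer exactly if the linear part fixes its
      vector, and conjugation by \<open>h\<close> turns the vector \<open>x\<close> into
      \<open>P x\<close>.\<close>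
    have "euc_conj h (mat 1, x) = (mat 1, P *v x)"
      using P by (simp add: conj_eq PP orthogonal_matrix_def)
    then have "(mat 1, P *v x) \<in> centralizer (A', a') \<longleftrightarrow> (mat 1, x) \<in> centralizer (A, a)"
      using mem by metis
    then have "A' *v (P *v x) = P *v x \<longleftrightarrow> A *v x = x"
      using one by (simp add: centralizer_normal_iff[OF A] centralizer_normal_iff[OF A'])
    moreover have "A' *v (P *v x) = P *v x \<longleftrightarrow> g x = x"
      using Pg PP by metis
    ultimately show ?thesis by simp
  qed
  have same: "(\<forall>x. \<beta> (A *v x) = A *v \<beta> x) \<and> \<beta> a = a \<longleftrightarrow> (\<forall>x. \<beta> (g x) = g (\<beta> x)) \<and> \<beta> b = b"
    if \<beta>: "orthogonal_transformation \<beta>" for \<beta>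
  proof -
    define B where "B = matrix \<beta>"
    have B: "orthogonal_matrix B" and \<beta>B: "\<beta> = (*v) B"
      using \<beta> by (auto simp: B_def orthogonal_transformation_matrix matrix_works fun_eq_iff)
    define B' where "B' = P ** B ** transpose P"
    have oB': "orthogonal_matrix B'"
      unfolding B'_def using B P by (intro orthogonal_matrix_mul) (auto simp: orthogonal_matrix_def)
    have B': "B' *v x = P *v (B *v (transpose P *v x))" for x
      by (simp add: B'_def matrix_vector_mul_assoc[symmetric])
    have comm: "(\<forall>x. B' *v (A' *v x) = A' *v (B' *v x)) \<longleftrightarrow> (\<forall>x. B *v g x = g (B *v x))"
    proof -
      have "B' *v (A' *v (P *v x)) = A' *v (B' *v (P *v x)) \<longleftrightarrow> B *v g x = g (B *v x)" for x
      proof -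
        have "B' *v (A' *v (P *v x)) = P *v (B *v g x)" by (simp add: B' g_def)
        moreover have "A' *v (B' *v (P *v x)) = P *v g (B *v x)" by (simp add: B' Pg PP)
        ultimately show ?thesis using PP(2) by metis
      qed
      then show ?thesis using PP(1) by metis
    qed
    have fixb: "B' *v a' = a' \<longleftrightarrow> B *v b = b"
      unfolding B' b_def using PP by metis
    show ?thesis
      unfolding \<beta>B
    proof
      assume "(\<forall>x. B *v (A *v x) = A *v (B *v x)) \<and> B *v a = a"
      then have "(B, 0) \<in> centralizer (A, a)"
        using B by (simp add: centralizer_normal_iff[OF A])
      then have "euc_conj h (B, 0) \<in> centralizer (A', a')" using mem by blast
      then show "(\<forall>x. B *v g x = g (B *v x)) \<and> B *v b = b"
        unfolding conj_eq B'_def[symmetric] centralizer_normal_iff[OF A'] comm fixb by blast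
    next
      assume "(\<forall>x. B *v g x = g (B *v x)) \<and> B *v b = b"
      then have "(B', 0) \<in> centralizer (A', a')"
        unfolding centralizer_normal_iff[OF A'] comm fixb using oB' by simp
      \<comment> \<open>The preimage may carry a translation part \<open>c\<close>; its linear part
        must be \<open>B\<close>, which yields the claim.\<close>
      then obtain k where k: "k \<in> centralizer (A, a)" "euc_conj h k = (B', 0)"
        using h(2) by (metis imageE)
      obtain C c where kC: "k = (C, c)" by fastforce
      have "P ** C ** transpose P = P ** B ** transpose P"
        using k(2) by (simp add: kC conj_eq B'_def)
      then have "(P ** C ** transpose P) *v x = (P ** B ** transpose P) *v x" for x
        by simp
      then have "P *v (C *v (transpose P *v x)) = P *v (B *v (transpose P *v x))" for x
        by (simp only: matrix_vector_mul_assoc[symmetric])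
      then have "C *v x = B *v x" for x
        using PP(2) by metis
      then have "C = B" by (simp add: matrix_eq)
      then show "(\<forall>x. B *v (A *v x) = A *v (B *v x)) \<and> B *v a = a"
        using k(1) by (simp add: kC centralizer_normal_iff[OF A])
    qed
  qed
  have conjg: "rot_space ((*v) A') c = (*v) P ` rot_space g c" for c
    by (rule rot_space_conj[OF oP]) (rule Pg)
  note eqs = rot_spaces_eq[OF f g A(2) gb _ fix_iff]
  \<comment> \<open>Minus the identity commutes with every linear map and fixes only
    \<open>0\<close>, so \<open>same\<close> compares \<open>a = 0\<close> with
    \<open>b = 0\<close>.\<close>
  have "a = 0 \<longleftrightarrow> b = 0"
  proof -
    have "orthogonal_transformation (\<lambda>x. - x :: real^'n)"
      by (simp add: orthogonal_transformation_neg)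
    moreover have neg: "- x = x \<longleftrightarrow> x = 0" for x :: "real^'n"
      by (auto simp: vec_eq_iff)
    ultimately show ?thesis
      using same[of "\<lambda>x. - x", unfolded neg]
      by (simp add: linear_neg orthogonal_transformation_linear f g)
  qed
  also have "b = 0 \<longleftrightarrow> a' = 0"
    using PP(1)[of a'] by (auto simp: b_def)
  finally show "a = 0 \<longleftrightarrow> a' = 0" .
  have "rot_space ((*v) A) 1 = rot_space g 1"
    using fix_iff by (simp add: rot_space_one[OF f] rot_space_one[OF g])
  then show "dim (rot_space ((*v) A) 1) = dim (rot_space ((*v) A') 1)"
    by (simp add: conjg dim_orthogonal_image[OF oP])
  have "rot_space ((*v) A) (-1) = rot_space g (-1)"
    by (rule eqs(1)) (use same in blast)
  then show "dim (rot_space ((*v) A) (-1)) = dim (rot_space ((*v) A') (-1))"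
    by (simp add: conjg dim_orthogonal_image[OF oP])
  have "rot_dims ((*v) A) = rot_dims g"
    by (rule eqs(2)) (use same in blast)
  also have "\<dots> = rot_dims ((*v) A')"
  proof (rule sym, rule rot_dims_conj[OF oP])
    show "P *v g x = A' *v (P *v x)" for x by (rule Pg)
  qed (use f' g in \<open>auto simp: orthogonal_transformation_linear\<close>)
  finally show "rot_dims ((*v) A) = rot_dims ((*v) A')" .
qed

section \<open>Normal form and the equivalence\<close>

lemma euc_normal_form:
  fixes f :: "('n::finite) euc"
  assumes "f \<in> Euc"
  obtains A a h where "orthogonal_matrix A" "A *v a = a" "h \<in> Euc" "f = euc_conj h (A, a)"
    "fst f = A" "elliptic f \<longleftrightarrow> a = 0"
proof -
  obtain A a where f: "f = (A, a)" "orthogonal_matrix A"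
    using assms by (auto simp: Euc_def)
  obtain a0 p where a0: "A *v a0 = a0" "a = a0 + (p - A *v p)"
    using translation_decomposition[OF f(2)] by metis
  have "f = euc_conj (mat 1, p) (A, a0)"
    by (simp add: f(1) a0(2) euc_conj_def euc_mult_def euc_inv_def transpose_mat
        linear_neg[OF matrix_vector_mul_linear])
  moreover have "(mat 1, p) \<in> Euc"
    by (simp add: Euc_def orthogonal_matrix_def transpose_mat)
  moreover have "elliptic f \<longleftrightarrow> a0 = 0"
    unfolding f(1) a0(2) by (rule elliptic_iff[OF f(2) a0(1)])
  moreover have "fst f = A" by (simp add: f)
  ultimately show thesis
    using that[OF f(2) a0(1)] by blast
qed

theorem mainTheorem2:
  fixes f g :: "('n::finite) euc"
  assumes "f \<in> Euc" and "g \<in> Euc"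
  shows "segre f = segre g \<longleftrightarrow> conjugate_subgroups (centralizer f) (centralizer g)"
proof -
  obtain A a h where A: "orthogonal_matrix A" "A *v a = a" and h: "h \<in> Euc" "f = euc_conj h (A, a)"
    and f: "fst f = A" "elliptic f \<longleftrightarrow> a = 0"
    using euc_normal_form[OF assms(1)] by metis
  obtain B b k where B: "orthogonal_matrix B" "B *v b = b" and k: "k \<in> Euc" "g = euc_conj k (B, b)"
    and g: "fst g = B" "elliptic g \<longleftrightarrow> b = 0"
    using euc_normal_form[OF assms(2)] by metis
  have r: "r_dim f = dim (rot_space ((*v) A) 1)" "r_dim g = dim (rot_space ((*v) B) 1)"
    using A B by (simp_all add: r_dim_def f g rot_space_one orthogonal_transformation_matrix_mult)
  have cf: "conjugate_subgroups (centralizer (A, a)) (centralizer f)"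
    unfolding h(2) by (rule conjugate_centralizer_conj[OF h(1)])
  have cg: "conjugate_subgroups (centralizer (B, b)) (centralizer g)"
    unfolding k(2) by (rule conjugate_centralizer_conj[OF k(1)])
  have "segre f = segre g \<longleftrightarrow> (a = 0 \<longleftrightarrow> b = 0) \<and>
      dim (rot_space ((*v) A) 1) = dim (rot_space ((*v) B) 1) \<and>
      rot_dims ((*v) A) = rot_dims ((*v) B) \<and>
      dim (rot_space ((*v) A) (-1)) = dim (rot_space ((*v) B) (-1))"
    using A B by (simp add: segre_def r f g segre_nonreal_eq_iff segre_real_eq_iff)
  also have "\<dots> \<longleftrightarrow> conjugate_subgroups (centralizer (A, a)) (centralizer (B, b))"
    using conjugate_centralizers_if[OF A B] conjugate_centralizers_only_if[OF A B] by blast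
  also have "\<dots> \<longleftrightarrow> conjugate_subgroups (centralizer f) (centralizer g)"
    using cf cg conjugate_subgroups_sym conjugate_subgroups_trans by blast
  finally show ?thesis .
qed

end
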